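(* Let $\beta\in\mathsf{k}^n$ and let $T_\beta$ be the $W_n(\mathsf{k})*\mathcal{A}_n$-module described in the context. Then $T_\beta^{\mathcal{A}_n}$ is a holonomic module for $W_n(\mathsf{k})^{\mathcal{A}_n}\simeq\mathcal{D}(\mathsf{k}^n/\mathcal{A}_n)$.
   Context: $\mathsf{k}$ is an algebraically closed field of characteristic zero. $W_n(\mathsf{k})$ is the Weyl algebra with generators $x_i,y_i$ ($1\le i\le n$) and relations $[x_i,x_j]=[y_i,y_j]=0$, $[y_i,x_j]=\delta_{ij}$. The alternating group $\mathcal{A}_n$ acts on it by permuting indices, $\pi(x_i)=x_{\pi(i)}$, $\pi(y_i)=y_{\pi(i)}$; $W_n(\mathsf{k})*\mathcal{A}_n$ is the skew group ring. $\mathcal{D}(\mathsf{k}^n/\mathcal{A}_n)$ is the ring of differential operators on the quotient variety; by a theorem of Levasseur it is isomorphic to $W_n(\mathsf{k})^{\mathcal{A}_n}$. Let $\delta_i\in\mathsf{k}^n$ be the $i$-th standard basis vector. The group $\mathbb{Z}^n\rtimes\mathcal{A}_n$ acts on $\mathsf{k}^n$: the $i$-th basis vector of $\mathbb{Z}^n$ acts by $\lambda\mapsto\lambda+\delta_i$ and $\pi\in\mathcal{A}_n$ acts by permuting coordinates so that $\pi(\delta_i)=\delta_{\pi(i)}$. Let $\mathfrak{B}$ be the orbit of $\beta$. $T_\beta$ is the vector space with basis the symbols $T(\lambda)$, $\lambda\in\mathfrak{B}$, with action $$x_iT(\lambda)=T(\lambda+\delta_i),\qquad y_iT(\lambda)=\lambda_iT(\lambda-\delta_i),\qquad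 \pi T(\lambda)=T(\pi(\lambda)).$$ $T_\beta^{\mathcal{A}_n}$ is its space of $\mathcal{A}_n$-invariants, a $W_n(\mathsf{k})^{\mathcal{A}_n}$-module. Every nonzero finitely generated $W_n(\mathsf{k})^{\mathcal{A}_n}$-module has Gelfand-Kirillov dimension at least $n$; a finitely generated module is holonomic if it is zero or has Gelfand-Kirillov dimension exactly $n$. *)

theory Defs
  imports
    "HOL-Analysis.Analysis"
    "HOL-Library.Poly_Mapping"
    "HOL-Combinatorics.Permutations"
    "HOL-Computational_Algebra.Polynomial"
begin

section \<open>Vector spaces with a given basis\<close>

definition fscale :: "'k::field \<Rightarrow> ('b \<Rightarrow>\<^sub>0 'k) \<Rightarrow> ('b \<Rightarrow>\<^sub>0 'k)"
  where "fscale c f = Poly_Mapping.map ((*) c) f"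

lemma lookup_fscale [simp]: "Poly_Mapping.lookup (fscale c f) b = c * Poly_Mapping.lookup f b"
  unfolding fscale_def by (simp add: Poly_Mapping.map.rep_eq when_def)

global_interpretation free_vs: vector_space "fscale :: 'k::field \<Rightarrow> ('b \<Rightarrow>\<^sub>0 'k) \<Rightarrow> ('b \<Rightarrow>\<^sub>0 'k)"
  by unfold_locales (auto intro!: poly_mapping_eqI simp: lookup_add algebra_simps)

abbreviation basis :: "'b \<Rightarrow> 'b \<Rightarrow>\<^sub>0 'k::field"
  where "basis b \<equiv> Poly_Mapping.single b 1"

text \<open>The linear map sending the basis vector \<open>basis b\<close> to \<open>\<phi> b\<close>.\<close>

definition lin_ext :: "('b \<Rightarrow> ('c \<Rightarrow>\<^sub>0 'k)) \<Rightarrow> ('b \<Rightarrow>\<^sub>0 'k::field) \<Rightarrow> ('c \<Rightarrow>\<^sub>0 'k)"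
  where "lin_ext \<phi> f = (\<Sum>b\<in>Poly_Mapping.keys f. fscale (Poly_Mapping.lookup f b) (\<phi> b))"

lemma lin_ext_superset:
  assumes "finite B" "Poly_Mapping.keys f \<subseteq> B"
  shows "lin_ext \<phi> f = (\<Sum>b\<in>B. fscale (Poly_Mapping.lookup f b) (\<phi> b))"
  unfolding lin_ext_def using assms
  by (intro sum.mono_neutral_left) (auto simp: in_keys_iff)

lemma lin_ext_zero [simp]: "lin_ext \<phi> 0 = 0"
  by (simp add: lin_ext_def)

lemma lin_ext_add: "lin_ext \<phi> (f + g) = lin_ext \<phi> f + lin_ext \<phi> g"
proof -
  let ?B = "Poly_Mapping.keys f \<union> Poly_Mapping.keys g"
  have "Poly_Mapping.keys (f + g) \<subseteq> ?B" by (rule keys_add)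
  then show ?thesis
    by (simp add: lin_ext_superset[of ?B] lookup_add free_vs.scale_left_distrib sum.distrib)
qed

lemma lin_ext_fscale: "lin_ext \<phi> (fscale c f) = fscale c (lin_ext \<phi> f)"
proof -
  have "Poly_Mapping.keys (fscale c f) \<subseteq> Poly_Mapping.keys f" by (auto simp: in_keys_iff)
  then show ?thesis
    by (simp add: lin_ext_superset[of "Poly_Mapping.keys f"] free_vs.scale_sum_right)
qed

lemma lin_ext_diff: "lin_ext \<phi> (f - g) = lin_ext \<phi> f - lin_ext \<phi> g"
  using lin_ext_add[of \<phi> "f - g" g] by simp

lemma lin_ext_sum: "lin_ext \<phi> (sum f I) = (\<Sum>i\<in>I. lin_ext \<phi> (f i))"
  by (induction I rule: infinite_finite_induct) (simp_all add: lin_ext_add)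

lemma lin_ext_single [simp]: "lin_ext \<phi> (Poly_Mapping.single b c) = fscale c (\<phi> b)"
  by (cases "c = 0") (simp_all add: lin_ext_def)

lemma fscale_single [simp]:
  "fscale c (Poly_Mapping.single b d) = Poly_Mapping.single b (c * d)"
  by (rule poly_mapping_eqI) (simp add: lookup_single when_def)

lemma poly_mapping_additive_induct [case_names zero single add]:
  assumes "P 0" "\<And>b c. P (Poly_Mapping.single b c)" "\<And>f g. P f \<Longrightarrow> P g \<Longrightarrow> P (f + g)"
  shows "P (f :: 'b \<Rightarrow>\<^sub>0 'k::field)"
proof -
  have "P (\<Sum>b\<in>B. Poly_Mapping.single b (Poly_Mapping.lookup f b))" if "finite B" for B
    using that by induction (auto intro: assms)
  moreover have "(\<Sum>b\<in>Poly_Mapping.keys f. Poly_Mapping.single b (Poly_Mapping.lookup f b)) = f"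
    by (rule poly_mapping_eqI) (auto simp: lookup_sum lookup_single when_def in_keys_iff sum.delta)
  ultimately show ?thesis by (metis finite_keys)
qed

lemma lin_ext_eqI:
  assumes "\<And>f g. F (f + g) = F f + F g" "\<And>c f. F (fscale c f) = fscale c (F f)"
    and "\<And>b. F (basis b) = \<phi> b"
  shows "F f = lin_ext \<phi> f"
proof (induction f rule: poly_mapping_additive_induct)
  case zero
  show ?case using assms(2)[of 0 0] by simp
next
  case (single b c)
  show ?case using assms(2)[of c "basis b"] by (simp add: assms(3))
next
  case (add f g)
  then show ?case by (simp add: assms(1) lin_ext_add)
qed


section \<open>The Weyl algebra by generators and relations\<close>

text \<open>A type of words with concatenation as \<open>+\<close>, so that the convolution product of
  \<^theory>\<open>HOL-Library.Poly_Mapping\<close> makes \<open>'a fword \<Rightarrow>\<^sub>0 'k\<close> the free associative algebra.\<close>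

datatype 'a fword = Word (letters: "'a list")

instantiation fword :: (type) monoid_add
begin
definition "0 = Word []"
definition "u + v = Word (letters u @ letters v)"
instance by standard (simp_all add: zero_fword_def plus_fword_def)
end

datatype 'i weyl_gen = X 'i | Y 'i

abbreviation fgen :: "'a \<Rightarrow> ('a fword \<Rightarrow>\<^sub>0 'k::field)"
  where "fgen g \<equiv> basis (Word [g])"

inductive_set ideal_generated :: "'r::ring_1 set \<Rightarrow> 'r set" for S where
  zero: "0 \<in> ideal_generated S"
| gen: "s \<in> S \<Longrightarrow> s \<in> ideal_generated S"
| add: "a \<in> ideal_generated S \<Longrightarrow> b \<in> ideal_generated S \<Longrightarrow> a + b \<in> ideal_generated S"
| mult_left: "a \<in> ideal_generated S \<Longrightarrow> r * a \<in> ideal_generated S"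
| mult_right: "a \<in> ideal_generated S \<Longrightarrow> a * r \<in> ideal_generated S"

lemma ideal_generated_uminus: "a \<in> ideal_generated S \<Longrightarrow> - a \<in> ideal_generated S"
  using ideal_generated.mult_left[of a S "-1"] by simp

lemma ideal_generated_diff:
  "a \<in> ideal_generated S \<Longrightarrow> b \<in> ideal_generated S \<Longrightarrow> a - b \<in> ideal_generated S"
  using ideal_generated.add[of a S "- b"] ideal_generated_uminus[of b S] by simp

definition weyl_relators :: "('i weyl_gen fword \<Rightarrow>\<^sub>0 'k::field) set" where
  "weyl_relators =
     {fgen (X i) * fgen (X j) - fgen (X j) * fgen (X i) | i j. True} \<union>
     {fgen (Y i) * fgen (Y j) - fgen (Y j) * fgen (Y i) | i j. True} \<union>
     {fgen (Y i) * fgen (X j) - fgen (X j) * fgen (Y i) - (if i = j then 1 else 0) | i j. True}"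

definition weyl_cong ::
    "('i weyl_gen fword \<Rightarrow>\<^sub>0 'k::field) \<Rightarrow> ('i weyl_gen fword \<Rightarrow>\<^sub>0 'k) \<Rightarrow> bool"
  where "weyl_cong f g \<longleftrightarrow> f - g \<in> ideal_generated weyl_relators"

lemma weyl_cong_equivp: "equivp weyl_cong"
proof (rule equivpI)
  show "reflp weyl_cong"
    by (auto simp: reflp_def weyl_cong_def ideal_generated.zero)
  show "symp weyl_cong"
    unfolding symp_def weyl_cong_def by (metis ideal_generated_uminus minus_diff_eq)
  show "transp weyl_cong"
    unfolding transp_def weyl_cong_def using ideal_generated.add by fastforce
qed

quotient_type (overloaded) ('i, 'k) weyl = "'i weyl_gen fword \<Rightarrow>\<^sub>0 ('k::field)" / weyl_cong
  by (rule weyl_cong_equivp)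

lemma fscale_eq_mult: "fscale c f = Poly_Mapping.single 0 c * (f :: 'a::monoid_add \<Rightarrow>\<^sub>0 'k::field)"
  by (induction f rule: poly_mapping_additive_induct)
    (simp_all add: mult_single free_vs.scale_right_distrib distrib_left)

lemma fscale_mult_left: "fscale c f * g = fscale c (f * (g :: 'a::monoid_add \<Rightarrow>\<^sub>0 'k::field))"
  by (simp add: fscale_eq_mult mult.assoc)

lemma fscale_mult_right: "f * fscale c g = fscale c (f * (g :: 'a::monoid_add \<Rightarrow>\<^sub>0 'k::field))"
proof (induction f rule: poly_mapping_additive_induct)
  case (single a d)
  show ?case
    by (induction g rule: poly_mapping_additive_induct)
      (simp_all add: mult_single free_vs.scale_right_distrib distrib_left mult.left_commute)
qed (simp_all add: free_vs.scale_right_distrib distrib_right)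

instantiation weyl :: (type, field) ring
begin

lift_definition zero_weyl :: "('a, 'b) weyl" is 0 .

lift_definition plus_weyl :: "('a, 'b) weyl \<Rightarrow> ('a, 'b) weyl \<Rightarrow> ('a, 'b) weyl" is "(+)"
  unfolding weyl_cong_def by (metis add_diff_add ideal_generated.add)

lift_definition uminus_weyl :: "('a, 'b) weyl \<Rightarrow> ('a, 'b) weyl" is uminus
  unfolding weyl_cong_def using ideal_generated_uminus by fastforce

lift_definition minus_weyl :: "('a, 'b) weyl \<Rightarrow> ('a, 'b) weyl \<Rightarrow> ('a, 'b) weyl" is "(-)"
proof -
  fix a a' b b' :: "'a weyl_gen fword \<Rightarrow>\<^sub>0 'b"
  assume "weyl_cong a a'" "weyl_cong b b'"
  moreover have "a - b - (a' - b') = (a - a') - (b - b')" by simp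
  ultimately show "weyl_cong (a - b) (a' - b')"
    unfolding weyl_cong_def by (simp only: ideal_generated_diff)
qed

lift_definition times_weyl :: "('a, 'b) weyl \<Rightarrow> ('a, 'b) weyl \<Rightarrow> ('a, 'b) weyl" is "(*)"
proof -
  fix a a' b b' :: "'a weyl_gen fword \<Rightarrow>\<^sub>0 'b"
  assume "weyl_cong a a'" "weyl_cong b b'"
  moreover have "a * b - a' * b' = (a - a') * b + a' * (b - b')"
    by (simp add: algebra_simps)
  ultimately show "weyl_cong (a * b) (a' * b')"
    unfolding weyl_cong_def
    by (simp add: ideal_generated.add ideal_generated.mult_left ideal_generated.mult_right)
qed

instance
  by standard
    (transfer, simp add: algebra_simps weyl_cong_def ideal_generated.zero)+

end

lift_definition weyl_scale :: "'k::field \<Rightarrow> ('i, 'k) weyl \<Rightarrow> ('i, 'k) weyl" is fscale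
  unfolding weyl_cong_def
  by (metis fscale_eq_mult ideal_generated.mult_left right_diff_distrib)

lift_definition wX :: "'i \<Rightarrow> ('i, 'k::field) weyl" is "\<lambda>i. fgen (X i)" .
lift_definition wY :: "'i \<Rightarrow> ('i, 'k::field) weyl" is "\<lambda>i. fgen (Y i)" .

text \<open>\<open>p(x\<^sub>i) = x\<^bsub>p(i)\<^esub>\<close>, \<open>p(y\<^sub>i) = y\<^bsub>p(i)\<^esub>\<close>.  A non-injective index map does not preserve the
  relators, hence the case distinction in \<open>weyl_perm\<close>.\<close>

definition fword_perm :: "('i \<Rightarrow> 'i) \<Rightarrow> 'i weyl_gen fword \<Rightarrow> 'i weyl_gen fword"
  where "fword_perm p = map_fword (map_weyl_gen p)"

definition free_perm ::
    "('i \<Rightarrow> 'i) \<Rightarrow> ('i weyl_gen fword \<Rightarrow>\<^sub>0 'k::field) \<Rightarrow> ('i weyl_gen fword \<Rightarrow>\<^sub>0 'k)"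
  where "free_perm p = lin_ext (\<lambda>w. basis (fword_perm p w))"

lemma fword_perm_simps [simp]:
  "fword_perm p 0 = 0" "fword_perm p (u + v) = fword_perm p u + fword_perm p v"
  by (cases u; cases v; simp add: fword_perm_def zero_fword_def plus_fword_def)+

lemma free_perm_mult: "free_perm p (f * g) = free_perm p f * free_perm p g"
proof (induction f rule: poly_mapping_additive_induct)
  case (single a d)
  show ?case
    by (induction g rule: poly_mapping_additive_induct)
      (simp_all add: free_perm_def mult_single lin_ext_add distrib_left)
qed (simp_all add: free_perm_def lin_ext_add distrib_right)

lemma free_perm_one [simp]: "free_perm p 1 = 1"
  using lin_ext_single[of "\<lambda>w. basis (fword_perm p w)" 0 1]
  by (simp add: free_perm_def single_one)

lemma free_perm_fgen [simp]: "free_perm p (fgen g) = fgen (map_weyl_gen p g)"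
  by (simp add: free_perm_def fword_perm_def)

lemma free_perm_add: "free_perm p (f + g) = free_perm p f + free_perm p g"
  by (simp add: free_perm_def lin_ext_add)

lemma free_perm_diff: "free_perm p (f - g) = free_perm p f - free_perm p g"
  by (simp add: free_perm_def lin_ext_diff)

lemma free_perm_zero [simp]: "free_perm p 0 = 0"
  by (simp add: free_perm_def)

lemma weyl_relators_cases:
  assumes "s \<in> weyl_relators"
  obtains (xx) i j where "s = fgen (X i) * fgen (X j) - fgen (X j) * fgen (X i)"
    | (yy) i j where "s = fgen (Y i) * fgen (Y j) - fgen (Y j) * fgen (Y i)"
    | (yx) i j where "s = fgen (Y i) * fgen (X j) - fgen (X j) * fgen (Y i) - (if i = j then 1 else 0)"
  using assms unfolding weyl_relators_def Un_iff mem_Collect_eq by (elim disjE exE conjE)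

lemma weyl_relators_intros:
  "fgen (X i) * fgen (X j) - fgen (X j) * fgen (X i) \<in> weyl_relators"
  "fgen (Y i) * fgen (Y j) - fgen (Y j) * fgen (Y i) \<in> weyl_relators"
  "fgen (Y i) * fgen (X j) - fgen (X j) * fgen (Y i) - (if i = j then 1 else 0) \<in> weyl_relators"
  unfolding weyl_relators_def by blast+

lemma free_perm_relators:
  assumes "inj p" "s \<in> weyl_relators"
  shows "free_perm p s \<in> weyl_relators"
proof -
  have eq: "free_perm p (if i = j then 1 else 0) = (if p i = p j then 1 else 0)" for i j
    using assms(1) by (simp add: inj_eq)
  note perm = eq free_perm_mult free_perm_diff free_perm_fgen weyl_gen.map
  from assms(2) show ?thesis
    by (cases rule: weyl_relators_cases) (simp_all only: perm weyl_relators_intros)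
qed

lemma free_perm_ideal:
  assumes "inj p" "f \<in> ideal_generated weyl_relators"
  shows "free_perm p f \<in> ideal_generated weyl_relators"
  using assms(2)
  by induction
    (auto simp: free_perm_mult free_perm_add intro: ideal_generated.intros free_perm_relators[OF assms(1)])

lift_definition weyl_perm :: "('i \<Rightarrow> 'i) \<Rightarrow> ('i, 'k::field) weyl \<Rightarrow> ('i, 'k) weyl"
  is "\<lambda>p. if inj p then free_perm p else id"
  unfolding weyl_cong_def
  by (auto simp only: if_True if_False id_apply free_perm_diff[symmetric] intro: free_perm_ideal split: if_split)


section \<open>The action on the space with basis \<open>T(\<lambda>)\<close>, \<open>\<lambda> \<in> k\<^sup>n\<close>\<close>

text \<open>The actions are defined on the span of all \<open>T(\<lambda>) = basis \<lambda>\<close>; the module attached to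
  an orbit is cut out afterwards as a subspace.\<close>

fun gen_act :: "'i::finite weyl_gen \<Rightarrow> ('k ^ 'i \<Rightarrow>\<^sub>0 'k::field) \<Rightarrow> ('k ^ 'i \<Rightarrow>\<^sub>0 'k)" where
  "gen_act (X i) = lin_ext (\<lambda>v. basis (v + axis i 1))"
| "gen_act (Y i) = lin_ext (\<lambda>v. fscale (v $ i) (basis (v - axis i 1)))"

definition word_act ::
    "'i::finite weyl_gen fword \<Rightarrow> ('k ^ 'i \<Rightarrow>\<^sub>0 'k::field) \<Rightarrow> ('k ^ 'i \<Rightarrow>\<^sub>0 'k)"
  where "word_act w = foldr gen_act (letters w)"

definition free_act ::
    "('i::finite weyl_gen fword \<Rightarrow>\<^sub>0 'k::field) \<Rightarrow> ('k ^ 'i \<Rightarrow>\<^sub>0 'k) \<Rightarrow> ('k ^ 'i \<Rightarrow>\<^sub>0 'k)"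
  where "free_act f t = lin_ext (\<lambda>w. word_act w t) f"

lemma gen_act_linear [simp]:
  "gen_act g (t + u) = gen_act g t + gen_act g u"
  "gen_act g (fscale c t) = fscale c (gen_act g t)"
  by (cases g; simp add: lin_ext_add lin_ext_fscale)+

lemma word_act_simps [simp]:
  "word_act 0 t = t" "word_act (u + v) t = word_act u (word_act v t)" "word_act (Word [g]) t = gen_act g t"
  by (simp_all add: word_act_def zero_fword_def plus_fword_def)

lemma word_act_linear [simp]:
  "word_act w (t + u) = word_act w t + word_act w u"
  "word_act w (fscale c t) = fscale c (word_act w t)"
proof -
  have "foldr gen_act gs (t + u) = foldr gen_act gs t + foldr gen_act gs u"
    "foldr gen_act gs (fscale c t) = fscale c (foldr gen_act gs t)" for gs
    by (induction gs) simp_all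
  then show "word_act w (t + u) = word_act w t + word_act w u"
    "word_act w (fscale c t) = fscale c (word_act w t)"
    by (simp_all add: word_act_def)
qed

lemma word_act_0 [simp]: "word_act w 0 = 0"
  using word_act_linear(2)[of w 0 0] by simp

lemma free_act_add_left: "free_act (f + g) t = free_act f t + free_act g t"
  by (simp add: free_act_def lin_ext_add)

lemma free_act_diff_left: "free_act (f - g) t = free_act f t - free_act g t"
  by (simp add: free_act_def lin_ext_diff)

lemma free_act_scale_left: "free_act (fscale c f) t = fscale c (free_act f t)"
  by (simp add: free_act_def lin_ext_fscale)

lemma free_act_0_left [simp]: "free_act 0 t = 0"
  by (simp add: free_act_def)

lemma free_act_single [simp]: "free_act (Poly_Mapping.single w c) t = fscale c (word_act w t)"
  by (simp add: free_act_def)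

lemma free_act_add_right: "free_act f (t + u) = free_act f t + free_act f u"
  by (induction f rule: poly_mapping_additive_induct)
    (simp_all add: free_act_add_left free_vs.scale_right_distrib algebra_simps)

lemma free_act_scale_right: "free_act f (fscale c t) = fscale c (free_act f t)"
  by (induction f rule: poly_mapping_additive_induct)
    (simp_all add: free_act_add_left free_vs.scale_right_distrib mult.commute)

lemma free_act_0_right [simp]: "free_act f 0 = 0"
  using free_act_scale_right[of f 0 0] by simp

lemma free_act_one [simp]: "free_act 1 t = t"
  using free_act_single[of 0 1 t] by (simp add: single_one)

lemma free_act_mult: "free_act (f * g) t = free_act f (free_act g t)"
proof (induction f rule: poly_mapping_additive_induct)
  case (single a d)
  show ?case
    by (induction g rule: poly_mapping_additive_induct)
      (simp_all add: mult_single distrib_left free_act_add_left free_vs.scale_right_distrib)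
qed (simp_all add: distrib_right free_act_add_left)

lemma poly_mapping_linear_eqI:
  assumes "\<And>f g. F (f + g) = F f + F g" "\<And>c f. F (fscale c f) = fscale c (F f)"
    and "\<And>f g. G (f + g) = G f + G g" "\<And>c f. G (fscale c f) = fscale c (G f)"
    and "\<And>b. F (basis b) = G (basis b)"
  shows "F (f :: 'b \<Rightarrow>\<^sub>0 'k::field) = (G f :: 'c \<Rightarrow>\<^sub>0 'k)"
  using lin_ext_eqI[of F "\<lambda>b. F (basis b)" f] lin_ext_eqI[of G "\<lambda>b. F (basis b)" f] assms by simp

lemma free_act_relators:
  assumes "s \<in> weyl_relators"
  shows "free_act s t = 0"
proof -
  have "free_act s t = lin_ext (\<lambda>_. 0) t"
  proof (rule lin_ext_eqI)
    fix v :: "'b ^ 'a"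
    show "free_act s (basis v) = 0"
      using assms unfolding weyl_relators_def Un_iff mem_Collect_eq
    proof (elim disjE exE conjE)
      fix i j
      assume s: "s = fgen (X i) * fgen (X j) - fgen (X j) * fgen (X i)"
      show ?thesis
        unfolding s by (simp add: free_act_diff_left free_act_mult algebra_simps)
    next
      fix i j
      assume s: "s = fgen (Y i) * fgen (Y j) - fgen (Y j) * fgen (Y i)"
      show ?thesis
        unfolding s by (cases "i = j") (simp_all add: free_act_diff_left free_act_mult axis_def algebra_simps)
    next
      fix i j
      assume s: "s = fgen (Y i) * fgen (X j) - fgen (X j) * fgen (Y i) - (if i = j then 1 else 0)"
      have eq: "v + axis j 1 - axis i 1 = v - axis i 1 + axis j 1" by simp
      show ?thesis
        unfolding s
        by (cases "i = j")
          (simp_all add: free_act_diff_left free_act_mult eq distrib_right single_add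
                    del: add_diff_cancel_right' diff_add_cancel, simp_all add: axis_def)
    qed
  qed (simp_all add: free_act_add_right free_act_scale_right)
  then show ?thesis by (simp add: lin_ext_def)
qed

lemma free_act_ideal:
  assumes "f \<in> ideal_generated weyl_relators"
  shows "free_act f t = 0"
  using assms
  by (induction arbitrary: t) (simp_all add: free_act_relators free_act_add_left free_act_mult)

instantiation weyl :: (finite, field) ring_1
begin
lift_definition one_weyl :: "('a, 'b) weyl" is 1 .
instance
proof
  show "(0 :: ('a, 'b) weyl) \<noteq> 1"
  proof (transfer, unfold weyl_cong_def, rule notI)
    assume "0 - 1 \<in> ideal_generated (weyl_relators :: ('a weyl_gen fword \<Rightarrow>\<^sub>0 'b) set)"
    from free_act_ideal[OF this, of "basis 0"]
    have "(basis 0 :: 'b ^ 'a \<Rightarrow>\<^sub>0 'b) = 0"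
      by (simp only: free_act_diff_left free_act_one free_act_0_left) simp
    then show False
      by (metis lookup_single_eq lookup_zero zero_neq_one)
  qed
qed (transfer, simp add: weyl_cong_def ideal_generated.zero)+
end

lift_definition weyl_act ::
    "('i::finite, 'k::field) weyl \<Rightarrow> ('k ^ 'i \<Rightarrow>\<^sub>0 'k) \<Rightarrow> ('k ^ 'i \<Rightarrow>\<^sub>0 'k)" is free_act
proof (rule ext)
  fix f g :: "'i weyl_gen fword \<Rightarrow>\<^sub>0 'k" and t
  assume "weyl_cong f g"
  then have "free_act (f - g) t = 0"
    unfolding weyl_cong_def by (rule free_act_ideal)
  then show "free_act f t = free_act g t" by (simp add: free_act_diff_left)
qed


text \<open>The inverse makes this a left action with \<open>p(\<delta>\<^sub>i) = \<delta>\<^bsub>p(i)\<^esub>\<close>; see \<open>perm_vec_axis\<close>.\<close>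

definition perm_vec :: "('i \<Rightarrow> 'i) \<Rightarrow> 'k ^ 'i \<Rightarrow> ('k ^ 'i :: finite)"
  where "perm_vec p v = (\<chi> i. v $ inv p i)"

lemma perm_vec_axis: "bij p \<Longrightarrow> perm_vec p (axis i a) = axis (p i) a"
  by (auto simp: perm_vec_def axis_def vec_eq_iff bij_inv_eq_iff[of p] bij_is_inj)

definition perm_act ::
    "('i \<Rightarrow> 'i) \<Rightarrow> ('k ^ 'i \<Rightarrow>\<^sub>0 'k) \<Rightarrow> ('k ^ 'i::finite \<Rightarrow>\<^sub>0 'k::field)"
  where "perm_act p = lin_ext (\<lambda>v. basis (perm_vec p v))"

lemma perm_act_linear [simp]:
  "perm_act p (t + u) = perm_act p t + perm_act p u"
  "perm_act p (fscale c t) = fscale c (perm_act p t)"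
  by (simp_all add: perm_act_def lin_ext_add lin_ext_fscale)

lemma perm_act_gen_act:
  fixes p :: "'i::finite \<Rightarrow> 'i" and t :: "'k ^ 'i \<Rightarrow>\<^sub>0 'k::field"
  assumes "bij p"
  shows "perm_act p (gen_act g t) = gen_act (map_weyl_gen p g) (perm_act p t)"
proof (rule poly_mapping_linear_eqI[of _ _ t])
  fix v :: "'k ^ 'i"
  have "perm_vec p (v + axis i 1) = perm_vec p v + axis (p i) 1"
    "perm_vec p (v - axis i 1) = perm_vec p v - axis (p i) 1" for i
    using perm_vec_axis[OF assms, of i "1::'k"] by (simp_all add: perm_vec_def vec_eq_iff)
  moreover have "perm_vec p v $ p i = v $ i" for i
    using assms by (simp add: perm_vec_def bij_is_inj)
  ultimately show "perm_act p (gen_act g (basis v)) = gen_act (map_weyl_gen p g) (perm_act p (basis v))"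
    by (cases g) (simp_all add: perm_act_def)
qed simp_all

lemma perm_act_word_act:
  assumes "bij p"
  shows "perm_act p (word_act w t) = word_act (fword_perm p w) (perm_act p t)"
proof (cases w)
  case (Word gs)
  show ?thesis
    unfolding Word by (induction gs)
      (simp_all add: word_act_def fword_perm_def perm_act_gen_act[OF assms])
qed

lemma perm_act_free_act:
  assumes "bij p"
  shows "perm_act p (free_act f t) = free_act (free_perm p f) (perm_act p t)"
  by (induction f rule: poly_mapping_additive_induct)
    (simp_all add: free_act_add_left free_perm_def lin_ext_add perm_act_word_act[OF assms],
     simp add: perm_act_def)

lemma perm_act_weyl_act:
  assumes "bij p"
  shows "perm_act p (weyl_act w t) = weyl_act (weyl_perm p w) (perm_act p t)"
  using assms by transfer (simp add: bij_is_inj perm_act_free_act)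

lemma perm_vec_compose: "bij p \<Longrightarrow> bij q \<Longrightarrow> perm_vec (p \<circ> q) v = perm_vec p (perm_vec q v)"
  by (simp add: perm_vec_def vec_eq_iff o_inv_distrib)

lemma perm_act_compose:
  "bij p \<Longrightarrow> bij q \<Longrightarrow> perm_act (p \<circ> q) t = perm_act p (perm_act q t)"
  by (rule poly_mapping_linear_eqI[of _ _ t])
    (simp_all del: o_apply add: perm_act_def perm_vec_compose lin_ext_add lin_ext_fscale)

lemma perm_act_id [simp]: "perm_act id t = t"
  by (rule poly_mapping_linear_eqI[of _ _ t]) (simp_all, simp add: perm_act_def perm_vec_def)

lemma weyl_act_add_left: "weyl_act (w + w') t = weyl_act w t + weyl_act w' t"
  by transfer (rule free_act_add_left)

lemma weyl_act_add_right: "weyl_act w (t + u) = weyl_act w t + weyl_act w u"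
  by transfer (rule free_act_add_right)

lemma weyl_act_mult: "weyl_act (w * w') t = weyl_act w (weyl_act w' t)"
  by transfer (rule free_act_mult)

lemma weyl_act_one [simp]: "weyl_act 1 t = t"
  by transfer simp

lemma weyl_act_0_left [simp]: "weyl_act 0 t = 0"
  by transfer simp

lemma weyl_act_scale_left: "weyl_act (weyl_scale c w) t = fscale c (weyl_act w t)"
  by transfer (rule free_act_scale_left)

lemma weyl_act_scale_right: "weyl_act w (fscale c t) = fscale c (weyl_act w t)"
  by transfer (rule free_act_scale_right)

lemma weyl_act_0_right [simp]: "weyl_act w 0 = 0"
  using weyl_act_scale_right[of w 0 0] by simp

lemma weyl_act_wX: "weyl_act (wX i) (basis v) = basis (v + axis i 1)"
  by transfer simp

lemma weyl_act_wY: "weyl_act (wY i) (basis v) = fscale (v $ i) (basis (v - axis i 1))"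
  by transfer simp

lemma weyl_relations:
  "wX i * wX j - wX j * wX i = (0 :: ('i::finite, 'k::field) weyl)"
  "wY i * wY j - wY j * wY i = (0 :: ('i, 'k) weyl)"
  "wY i * wX j - wX j * wY i = (if i = j then 1 else 0 :: ('i, 'k) weyl)"
proof -
  show "wX i * wX j - wX j * wX i = (0 :: ('i, 'k) weyl)"
    by transfer (auto simp: weyl_cong_def weyl_relators_def intro!: ideal_generated.gen)
  show "wY i * wY j - wY j * wY i = (0 :: ('i, 'k) weyl)"
    by transfer (auto simp: weyl_cong_def weyl_relators_def intro!: ideal_generated.gen)
  show "wY i * wX j - wX j * wY i = (if i = j then 1 else 0 :: ('i, 'k) weyl)"
    by transfer (auto simp only: weyl_cong_def weyl_relators_def intro!: ideal_generated.gen)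
qed

lemma weyl_perm_add: "inj p \<Longrightarrow> weyl_perm p (w + w') = weyl_perm p w + weyl_perm p w'"
  by transfer (simp add: free_perm_add weyl_cong_def ideal_generated.zero)

lemma weyl_perm_mult: "inj p \<Longrightarrow> weyl_perm p (w * w') = weyl_perm p w * weyl_perm p w'"
  by transfer (simp add: free_perm_mult weyl_cong_def ideal_generated.zero)

lemma weyl_perm_one [simp]: "inj p \<Longrightarrow> weyl_perm p 1 = 1"
  by transfer (simp add: weyl_cong_def ideal_generated.zero)

lemma weyl_perm_zero [simp]: "inj p \<Longrightarrow> weyl_perm p 0 = 0"
  by transfer (simp add: weyl_cong_def ideal_generated.zero)

lemma weyl_perm_scale: "inj p \<Longrightarrow> weyl_perm p (weyl_scale c w) = weyl_scale c (weyl_perm p w)"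
  by transfer (simp add: free_perm_def lin_ext_fscale weyl_cong_def ideal_generated.zero)

lemma weyl_perm_wX [simp]: "inj p \<Longrightarrow> weyl_perm p (wX i) = wX (p i)"
  by transfer (simp add: weyl_cong_def ideal_generated.zero)

lemma weyl_perm_wY [simp]: "inj p \<Longrightarrow> weyl_perm p (wY i) = wY (p i)"
  by transfer (simp add: weyl_cong_def ideal_generated.zero)

lemma free_perm_compose: "free_perm (p \<circ> q) f = free_perm p (free_perm q f)"
proof -
  have "map_weyl_gen (p \<circ> q) = map_weyl_gen p \<circ> map_weyl_gen q"
    by (simp add: weyl_gen.map_comp fun_eq_iff)
  then have "fword_perm (p \<circ> q) w = fword_perm p (fword_perm q w)" for w
    by (simp only: fword_perm_def fword.map_comp)
  then show ?thesis
    by - (rule poly_mapping_linear_eqI[of _ _ f]; simp add: free_perm_def lin_ext_add lin_ext_fscale del: o_apply id_apply)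
qed

lemma free_perm_id [simp]: "free_perm id f = f"
proof -
  have "fword_perm id w = w" for w :: "'a weyl_gen fword"
    by (simp only: fword_perm_def weyl_gen.map_id0 fword.map_id)
  then show ?thesis
    by - (rule poly_mapping_linear_eqI[of _ _ f]; simp add: free_perm_def lin_ext_add lin_ext_fscale del: o_apply id_apply)
qed

lemma weyl_perm_compose:
  "inj p \<Longrightarrow> inj q \<Longrightarrow> weyl_perm (p \<circ> q) w = weyl_perm p (weyl_perm q w)"
  by transfer (simp add: free_perm_compose inj_compose weyl_cong_def ideal_generated.zero del: o_apply)

lemma weyl_perm_id [simp]: "weyl_perm id w = w"
  by transfer (simp add: weyl_cong_def ideal_generated.zero)

lemma weyl_scale_mult_left: "weyl_scale c w * w' = weyl_scale c (w * w')"
  by transfer (simp add: fscale_mult_left weyl_cong_def ideal_generated.zero)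

lemma weyl_scale_mult_right: "w * weyl_scale c w' = weyl_scale c (w * w')"
  by transfer (simp add: fscale_mult_right weyl_cong_def ideal_generated.zero)

global_interpretation weyl_vs: vector_space "weyl_scale :: 'k::field \<Rightarrow> ('i, 'k) weyl \<Rightarrow> ('i, 'k) weyl"
  by unfold_locales
    (transfer, simp add: weyl_cong_def ideal_generated.zero
       free_vs.scale_right_distrib free_vs.scale_left_distrib)+


section \<open>The alternating group and the skew group ring\<close>

definition Alt :: "('i::finite \<Rightarrow> 'i) set"
  where "Alt = {p. p permutes UNIV \<and> evenperm p}"

lemma Alt_bij: "p \<in> Alt \<Longrightarrow> bij p"
  unfolding Alt_def by (blast intro: permutes_bij)

lemma Alt_inj: "p \<in> Alt \<Longrightarrow> inj p"
  by (simp add: Alt_bij bij_is_inj)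

lemma finite_Alt [simp]: "finite Alt"
  by (rule finite_subset[of _ UNIV]) simp_all

lemma Alt_id [simp]: "id \<in> Alt"
  by (simp add: Alt_def permutes_id)

lemma Alt_permutation: "p \<in> Alt \<Longrightarrow> permutation p"
  by (auto simp: Alt_def permutation_permutes)

lemma Alt_compose: "p \<in> Alt \<Longrightarrow> q \<in> Alt \<Longrightarrow> p \<circ> q \<in> Alt"
  using Alt_permutation[of p] Alt_permutation[of q]
  by (auto simp: Alt_def evenperm_comp permutes_compose)

lemma Alt_inv: "p \<in> Alt \<Longrightarrow> inv p \<in> Alt"
  using Alt_permutation[of p] by (auto simp: Alt_def evenperm_inv permutes_inv)

text \<open>The element \<open>s\<close> stands for the formal sum of the \<open>s p \<cdot> p\<close>, with multiplication
  determined by \<open>p \<cdot> w = p(w) \<cdot> p\<close>.\<close>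

typedef (overloaded) ('i::finite, 'k::field) skew_weyl =
  "{s :: ('i \<Rightarrow> 'i) \<Rightarrow> ('i, 'k) weyl. \<forall>p. p \<notin> Alt \<longrightarrow> s p = 0}"
  morphisms skew_coeff Abs_skew
  by (rule exI[of _ "\<lambda>_. 0"]) simp

setup_lifting type_definition_skew_weyl


lemma Alt_translate: "p \<in> Alt \<Longrightarrow> r \<notin> Alt \<Longrightarrow> inv p \<circ> r \<notin> Alt"
  by (metis Alt_bij Alt_compose bij_is_surj comp_assoc id_comp surj_iff)

lemma bij_betw_Alt_translate:
  fixes p :: "'a::finite \<Rightarrow> 'a"
  assumes "p \<in> Alt"
  shows "bij_betw (\<lambda>q. p \<circ> q) Alt Alt"
proof (rule bij_betwI[of _ _ _ "\<lambda>q. inv p \<circ> q"])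
  show "(\<lambda>q. p \<circ> q) \<in> Alt \<rightarrow> Alt" "(\<lambda>q. inv p \<circ> q) \<in> Alt \<rightarrow> Alt"
    using assms Alt_compose Alt_inv by blast+
  show "inv p \<circ> (p \<circ> q) = q" for q :: "'a \<Rightarrow> 'a"
    using Alt_inj[OF assms] by (simp add: o_assoc)
  show "p \<circ> (inv p \<circ> q) = q" for q :: "'a \<Rightarrow> 'a"
    using Alt_bij[OF assms] by (simp add: o_assoc bij_is_surj surj_iff[THEN iffD1])
qed

lemma weyl_perm_sum: "inj p \<Longrightarrow> weyl_perm p (sum f I) = (\<Sum>i\<in>I. weyl_perm p (f i))"
  by (induction I rule: infinite_finite_induct) (simp_all add: weyl_perm_add)

instantiation skew_weyl :: (finite, field) ring_1
begin

lift_definition zero_skew_weyl :: "('a, 'b) skew_weyl" is "\<lambda>_. 0" by simp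

lift_definition one_skew_weyl :: "('a, 'b) skew_weyl" is "\<lambda>p. if p = id then 1 else 0" by auto

lift_definition plus_skew_weyl ::
    "('a, 'b) skew_weyl \<Rightarrow> ('a, 'b) skew_weyl \<Rightarrow> ('a, 'b) skew_weyl"
  is "\<lambda>s t p. s p + t p" by simp

lift_definition uminus_skew_weyl :: "('a, 'b) skew_weyl \<Rightarrow> ('a, 'b) skew_weyl"
  is "\<lambda>s p. - s p" by simp

lift_definition minus_skew_weyl ::
    "('a, 'b) skew_weyl \<Rightarrow> ('a, 'b) skew_weyl \<Rightarrow> ('a, 'b) skew_weyl"
  is "\<lambda>s t p. s p - t p" by simp

lift_definition times_skew_weyl ::
    "('a, 'b) skew_weyl \<Rightarrow> ('a, 'b) skew_weyl \<Rightarrow> ('a, 'b) skew_weyl"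
  is "\<lambda>s t r. \<Sum>p\<in>Alt. s p * weyl_perm p (t (inv p \<circ> r))"
  by (auto intro!: sum.neutral simp: Alt_translate Alt_inj simp del: o_apply)

instance
proof
  fix a b c :: "('a, 'b) skew_weyl"
  show "a + b + c = a + (b + c)" by transfer (simp add: add.assoc)
  show "a + b = b + a" by transfer (simp add: add.commute)
  show "0 + a = a" by transfer simp
  show "- a + a = 0" by transfer simp
  show "a - b = a + - b" by transfer simp
  show "(a + b) * c = a * c + b * c"
    by transfer (simp add: distrib_right sum.distrib)
  show "a * (b + c) = a * b + a * c"
    by transfer (simp add: distrib_left sum.distrib weyl_perm_add Alt_inj fun_eq_iff)
  show "(0 :: ('a, 'b) skew_weyl) \<noteq> 1"
    by transfer (auto simp: fun_eq_iff)
  show "1 * a = a"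
  proof (transfer, rule ext)
    fix a :: "('a \<Rightarrow> 'a) \<Rightarrow> ('a, 'b) weyl" and r :: "'a \<Rightarrow> 'a"
    have "(if p = id then 1 else 0) * weyl_perm p (a (inv p \<circ> r)) = (if p = id then a r else 0)" for p
      by simp
    then show "(\<Sum>p\<in>Alt. (if p = id then 1 else 0) * weyl_perm p (a (inv p \<circ> r))) = a r"
      by (simp only:) simp
  qed
  show "a * 1 = a"
  proof (transfer, rule ext)
    fix a :: "('a \<Rightarrow> 'a) \<Rightarrow> ('a, 'b) weyl" and r :: "'a \<Rightarrow> 'a"
    assume a: "\<forall>p. p \<notin> Alt \<longrightarrow> a p = 0"
    have "inv p \<circ> r = id \<longleftrightarrow> r = p" if "p \<in> Alt" for p :: "'a \<Rightarrow> 'a"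
      using Alt_bij[OF that]
      by (metis bij_is_inj bij_is_surj comp_assoc comp_id id_comp inv_o_cancel surj_iff)
    then have "(\<Sum>p\<in>Alt. a p * weyl_perm p (if inv p \<circ> r = id then 1 else 0))
        = (\<Sum>p\<in>Alt. if r = p then a p else 0)"
      by (intro sum.cong) (auto simp: Alt_inj)
    also have "\<dots> = a r" using a by simp
    finally show "(\<Sum>p\<in>Alt. a p * weyl_perm p (if inv p \<circ> r = id then 1 else 0)) = a r" .
  qed
  show "a * b * c = a * (b * c)"
  proof (transfer, rule ext)
    fix a b c :: "('a \<Rightarrow> 'a) \<Rightarrow> ('a, 'b) weyl" and r :: "'a \<Rightarrow> 'a"
    have "(\<Sum>q\<in>Alt. (\<Sum>p\<in>Alt. a p * weyl_perm p (b (inv p \<circ> q))) * weyl_perm q (c (inv q \<circ> r)))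
        = (\<Sum>p\<in>Alt. \<Sum>q\<in>Alt. a p * weyl_perm p (b (inv p \<circ> q)) * weyl_perm q (c (inv q \<circ> r)))"
      by (simp only: sum_distrib_right) (rule sum.swap)
    also have "\<dots> = (\<Sum>p\<in>Alt. \<Sum>q\<in>Alt.
        a p * weyl_perm p (b q) * weyl_perm (p \<circ> q) (c (inv q \<circ> (inv p \<circ> r))))"
    proof (rule sum.cong[OF refl])
      fix p :: "'a \<Rightarrow> 'a" assume p: "p \<in> Alt"
      have "inv p \<circ> (p \<circ> q) = q" for q :: "'a \<Rightarrow> 'a"
        using Alt_inj[OF p] by (simp add: o_assoc)
      moreover have "inv (p \<circ> q) \<circ> r = inv q \<circ> (inv p \<circ> r)" if "q \<in> Alt" for q :: "'a \<Rightarrow> 'a"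
        using Alt_bij[OF p] Alt_bij[OF that] by (simp add: o_inv_distrib o_assoc)
      ultimately show "(\<Sum>q\<in>Alt. a p * weyl_perm p (b (inv p \<circ> q)) * weyl_perm q (c (inv q \<circ> r)))
          = (\<Sum>q\<in>Alt. a p * weyl_perm p (b q) * weyl_perm (p \<circ> q) (c (inv q \<circ> (inv p \<circ> r))))"
        by (subst sum.reindex_bij_betw[OF bij_betw_Alt_translate[OF p], symmetric])
          (simp del: o_apply cong: sum.cong)
    qed
    also have "\<dots> = (\<Sum>p\<in>Alt. a p * weyl_perm p
        (\<Sum>q\<in>Alt. b q * weyl_perm q (c (inv q \<circ> (inv p \<circ> r)))))"
      by (intro sum.cong)
        (simp_all del: o_apply add: weyl_perm_sum Alt_inj weyl_perm_mult weyl_perm_compose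
          sum_distrib_left mult.assoc)
    finally show "(\<Sum>q\<in>Alt. (\<Sum>p\<in>Alt. a p * weyl_perm p (b (inv p \<circ> q))) * weyl_perm q (c (inv q \<circ> r)))
        = (\<Sum>p\<in>Alt. a p * weyl_perm p (\<Sum>q\<in>Alt. b q * weyl_perm q (c (inv q \<circ> (inv p \<circ> r)))))" .
  qed
qed

end

lift_definition skew_scale :: "'k::field \<Rightarrow> ('i::finite, 'k) skew_weyl \<Rightarrow> ('i, 'k) skew_weyl"
  is "\<lambda>c s p. weyl_scale c (s p)" by simp

definition skew_of_weyl :: "('i::finite, 'k::field) weyl \<Rightarrow> ('i, 'k) skew_weyl"
  where "skew_of_weyl w = Abs_skew (\<lambda>p. if p = id then w else 0)"

lemma skew_coeff_of_weyl [simp]: "skew_coeff (skew_of_weyl w) = (\<lambda>p. if p = id then w else 0)"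
  unfolding skew_of_weyl_def by (rule Abs_skew_inverse) auto

lift_definition skew_of_perm :: "('i::finite \<Rightarrow> 'i) \<Rightarrow> ('i, 'k::field) skew_weyl"
  is "\<lambda>p q. if q = p \<and> p \<in> Alt then 1 else 0" by auto

lift_definition skew_act ::
    "('i::finite, 'k::field) skew_weyl \<Rightarrow> ('k ^ 'i \<Rightarrow>\<^sub>0 'k) \<Rightarrow> ('k ^ 'i \<Rightarrow>\<^sub>0 'k)"
  is "\<lambda>s t. \<Sum>p\<in>Alt. weyl_act (s p) (perm_act p t)" .

lemma skew_act_weyl [simp]: "skew_act (skew_of_weyl w) t = weyl_act w t"
proof -
  have "weyl_act (if p = id then w else 0) (perm_act p t) = (if p = id then weyl_act w t else 0)" for p
    by simp
  then show ?thesis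
    by (simp only: skew_act.rep_eq skew_coeff_of_weyl) simp
qed

lemma skew_act_perm [simp]: "p \<in> Alt \<Longrightarrow> skew_act (skew_of_perm p) t = perm_act p t"
proof -
  assume p: "p \<in> Alt"
  have "weyl_act (if q = p \<and> p \<in> Alt then 1 else 0) (perm_act q t)
      = (if q = p then perm_act p t else 0)" for q
    using p by simp
  with p show ?thesis
    by (simp only: skew_act.rep_eq skew_of_perm.rep_eq) simp
qed


lemma skew_act_relation:
  fixes p :: "'a::finite \<Rightarrow> 'a" and w :: "('a, 'b::field) weyl"
  assumes "p \<in> Alt"
  shows "skew_of_perm p * skew_of_weyl w = skew_of_weyl (weyl_perm p w) * skew_of_perm p"
proof (rule skew_coeff_inject[THEN iffD1], rule ext)
  fix r :: "'a \<Rightarrow> 'a"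
  have *: "inv p \<circ> r = id \<longleftrightarrow> r = p"
    using Alt_bij[OF assms]
    by (metis bij_is_inj bij_is_surj comp_assoc comp_id id_comp inv_o_cancel surj_iff)
  have "skew_coeff (skew_of_perm p * skew_of_weyl w) r
      = (\<Sum>q\<in>Alt. if q = p then (if inv p \<circ> r = id then weyl_perm p w else 0) else 0)"
    unfolding times_skew_weyl.rep_eq skew_of_perm.rep_eq skew_coeff_of_weyl
    using assms by (intro sum.cong) (auto simp: Alt_inj)
  also have "\<dots> = (\<Sum>q\<in>Alt. if q = (id :: 'a \<Rightarrow> 'a) then (if r = p then weyl_perm p w else 0) else 0)"
    using assms by (simp add: *)
  also have "\<dots> = skew_coeff (skew_of_weyl (weyl_perm p w) * skew_of_perm p) r"
    unfolding times_skew_weyl.rep_eq skew_of_perm.rep_eq skew_coeff_of_weyl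
    using assms by (intro sum.cong) auto
  finally show "skew_coeff (skew_of_perm p * skew_of_weyl w) r
      = skew_coeff (skew_of_weyl (weyl_perm p w) * skew_of_perm p) r" .
qed


section \<open>Modules over algebras and Gelfand-Kirillov dimension\<close>

text \<open>A left module \<open>M\<close> over a unital subalgebra \<open>A\<close> of an associative algebra; both are
  given as subsets of ambient types.\<close>

locale algebra_module =
  algebra: vector_space scA + module: vector_space scM
  for scA :: "'k::field \<Rightarrow> 'a::ring_1 \<Rightarrow> 'a" and scM :: "'k \<Rightarrow> 'm::ab_group_add \<Rightarrow> 'm" +
  fixes A :: "'a set" and M :: "'m set" and act :: "'a \<Rightarrow> 'm \<Rightarrow> 'm"
  assumes scale_mult_left: "scA c a * b = scA c (a * b)"
    and scale_mult_right: "a * scA c b = scA c (a * b)"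
    and subspace_A: "algebra.subspace A"
    and one_closed: "1 \<in> A"
    and mult_closed: "a \<in> A \<Longrightarrow> b \<in> A \<Longrightarrow> a * b \<in> A"
    and subspace_M: "module.subspace M"
    and act_closed: "a \<in> A \<Longrightarrow> m \<in> M \<Longrightarrow> act a m \<in> M"
    and act_add_left: "a \<in> A \<Longrightarrow> b \<in> A \<Longrightarrow> m \<in> M \<Longrightarrow> act (a + b) m = act a m + act b m"
    and act_add_right: "a \<in> A \<Longrightarrow> m \<in> M \<Longrightarrow> m' \<in> M \<Longrightarrow> act a (m + m') = act a m + act a m'"
    and act_scale_left: "a \<in> A \<Longrightarrow> m \<in> M \<Longrightarrow> act (scA c a) m = scM c (act a m)"
    and act_scale_right: "a \<in> A \<Longrightarrow> m \<in> M \<Longrightarrow> act a (scM c m) = scM c (act a m)"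
    and act_one: "m \<in> M \<Longrightarrow> act 1 m = m"
    and act_mult: "a \<in> A \<Longrightarrow> b \<in> A \<Longrightarrow> m \<in> M \<Longrightarrow> act (a * b) m = act a (act b m)"

definition finitely_generated_module ::
    "'a set \<Rightarrow> 'm::ab_group_add set \<Rightarrow> ('a \<Rightarrow> 'm \<Rightarrow> 'm) \<Rightarrow> bool"
  where "finitely_generated_module A M act \<longleftrightarrow>
    (\<exists>S. finite S \<and> S \<subseteq> M \<and>
      (\<forall>m\<in>M. \<exists>c. (\<forall>s\<in>S. c s \<in> A) \<and> m = (\<Sum>s\<in>S. act (c s) s)))"

definition finite_dim_subspace ::
    "('k::field \<Rightarrow> 'v::ab_group_add \<Rightarrow> 'v) \<Rightarrow> 'v set \<Rightarrow> bool"
  where "finite_dim_subspace sc V \<longleftrightarrow> (\<exists>B. finite B \<and> V = module.span sc B)"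

text \<open>\<open>power_space scM act V F m\<close> is \<open>V\<^sup>m F\<close>.\<close>

fun power_space ::
    "('k::field \<Rightarrow> 'm::ab_group_add \<Rightarrow> 'm) \<Rightarrow> ('a \<Rightarrow> 'm \<Rightarrow> 'm) \<Rightarrow> 'a set \<Rightarrow> 'm set \<Rightarrow> nat \<Rightarrow> 'm set"
where
  "power_space scM act V F 0 = F"
| "power_space scM act V F (Suc m) =
     module.span scM {act v u | v u. v \<in> V \<and> u \<in> power_space scM act V F m}"

text \<open>The supremum, over finite-dimensional subspaces \<open>1 \<in> V \<subseteq> A\<close> and \<open>F \<subseteq> M\<close>, of
  \<open>lim sup\<^sub>m log\<^sub>m dim (V\<^sup>m F)\<close>.  The convention \<open>log m 0 = 0\<close> only affects the zero module,
  which the definition of holonomicity treats separately.\<close>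

definition GK_dim ::
    "('k::field \<Rightarrow> 'a::ring_1 \<Rightarrow> 'a) \<Rightarrow> ('k \<Rightarrow> 'm::ab_group_add \<Rightarrow> 'm) \<Rightarrow>
     'a set \<Rightarrow> 'm set \<Rightarrow> ('a \<Rightarrow> 'm \<Rightarrow> 'm) \<Rightarrow> ereal"
  where "GK_dim scA scM A M act =
    (SUP (V, F) \<in> {(V, F). finite_dim_subspace scA V \<and> 1 \<in> V \<and> V \<subseteq> A \<and>
                           finite_dim_subspace scM F \<and> F \<subseteq> M}.
       limsup (\<lambda>m. ereal (log (real m) (real (vector_space.dim scM (power_space scM act V F m))))))"


section \<open>The modules \<open>T\<^sub>\<beta>\<close> and their invariants\<close>

definition weyl_invariants :: "('i::finite, 'k::field) weyl set"
  where "weyl_invariants = {w. \<forall>p\<in>Alt. weyl_perm p w = w}"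

text \<open>Holonomicity over the algebra of alternating invariants of the Weyl algebra in
  \<open>n = CARD('i)\<close> pairs of variables.\<close>

definition holonomic ::
    "('k \<Rightarrow> 'm::ab_group_add \<Rightarrow> 'm) \<Rightarrow> 'm set \<Rightarrow> (('i::finite, 'k::field) weyl \<Rightarrow> 'm \<Rightarrow> 'm) \<Rightarrow> bool"
  where "holonomic scM M act \<longleftrightarrow>
    algebra_module weyl_scale scM weyl_invariants M act \<and>
    finitely_generated_module (weyl_invariants :: ('i, 'k) weyl set) M act \<and>
    (M = {0} \<or> GK_dim weyl_scale scM weyl_invariants M act = ereal (real CARD('i)))"

text \<open>The orbit under \<open>\<int>\<^sup>n \<rtimes> A\<^sub>n\<close>, whose elements act by \<open>v \<mapsto> p(v) + z\<close>.\<close>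

definition affine_orbit :: "'k ^ 'i \<Rightarrow> ('k::field ^ 'i::finite) set"
  where "affine_orbit \<beta> = {perm_vec p \<beta> + (\<chi> i. of_int (z $ i)) | p (z :: int ^ 'i). p \<in> Alt}"

definition T_module :: "'k ^ 'i \<Rightarrow> ('k ^ 'i::finite \<Rightarrow>\<^sub>0 'k::field) set"
  where "T_module \<beta> = {t. Poly_Mapping.keys t \<subseteq> affine_orbit \<beta>}"

definition T_invariants :: "'k ^ 'i \<Rightarrow> ('k ^ 'i::finite \<Rightarrow>\<^sub>0 'k::field) set"
  where "T_invariants \<beta> = {t \<in> T_module \<beta>. \<forall>p\<in>Alt. skew_act (skew_of_perm p) t = t}"

lemma affine_orbit_self: "\<beta> \<in> affine_orbit \<beta>"
  unfolding affine_orbit_def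
  by (auto intro!: exI[of _ id] exI[of _ "0 :: int ^ _"] simp: perm_vec_def vec_eq_iff)

lemma affine_orbit_translate:
  assumes "v \<in> affine_orbit \<beta>"
  shows "v + axis i 1 \<in> affine_orbit \<beta>" "v - axis i 1 \<in> affine_orbit \<beta>"
proof -
  obtain p z where p: "p \<in> Alt" and v: "v = perm_vec p \<beta> + (\<chi> j. of_int (z $ j))"
    using assms unfolding affine_orbit_def by blast
  have "v + axis i 1 = perm_vec p \<beta> + (\<chi> j. of_int ((z + axis i 1) $ j))"
    "v - axis i 1 = perm_vec p \<beta> + (\<chi> j. of_int ((z - axis i 1) $ j))"
    by (simp_all add: v vec_eq_iff axis_def)
  with p show "v + axis i 1 \<in> affine_orbit \<beta>" "v - axis i 1 \<in> affine_orbit \<beta>"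
    unfolding affine_orbit_def by blast+
qed

lemma affine_orbit_perm:
  assumes "v \<in> affine_orbit \<beta>" "q \<in> Alt"
  shows "perm_vec q v \<in> affine_orbit \<beta>"
proof -
  obtain p z where p: "p \<in> Alt" and v: "v = perm_vec p \<beta> + (\<chi> j. of_int (z $ j))"
    using assms unfolding affine_orbit_def by blast
  have "perm_vec q v = perm_vec (q \<circ> p) \<beta> + (\<chi> j. of_int (perm_vec q z $ j))"
    using perm_vec_compose[OF Alt_bij[OF assms(2)] Alt_bij[OF p], of \<beta>]
    by (simp add: v perm_vec_def vec_eq_iff)
  then show ?thesis
    unfolding affine_orbit_def using Alt_compose[OF assms(2) p] by blast
qed

lemma T_module_subspace: "free_vs.subspace (T_module \<beta>)"
proof (rule free_vs.subspaceI)
  show "0 \<in> T_module \<beta>" by (simp add: T_module_def)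
  show "t + u \<in> T_module \<beta>" if "t \<in> T_module \<beta>" "u \<in> T_module \<beta>" for t u
    using that keys_add[of t u] unfolding T_module_def by blast
  show "fscale c t \<in> T_module \<beta>" if "t \<in> T_module \<beta>" for c t
    using that unfolding T_module_def by (auto simp: in_keys_iff)
qed

lemma lin_ext_T_module:
  assumes "t \<in> T_module \<beta>" "\<And>v. v \<in> affine_orbit \<beta> \<Longrightarrow> \<phi> v \<in> T_module \<beta>"
  shows "lin_ext \<phi> t \<in> T_module \<beta>"
  unfolding lin_ext_def
proof (rule free_vs.subspace_sum[OF T_module_subspace])
  fix v assume "v \<in> Poly_Mapping.keys t"
  with assms have "\<phi> v \<in> T_module \<beta>" unfolding T_module_def by blast
  then show "fscale (Poly_Mapping.lookup t v) (\<phi> v) \<in> T_module \<beta>"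
    by (rule free_vs.subspace_scale[OF T_module_subspace])
qed

lemma basis_in_T_module: "v \<in> affine_orbit \<beta> \<Longrightarrow> basis v \<in> T_module \<beta>"
  by (simp add: T_module_def)

lemma gen_act_T_module: "t \<in> T_module \<beta> \<Longrightarrow> gen_act g t \<in> T_module \<beta>"
  by (cases g) (auto simp del: fscale_single intro!: lin_ext_T_module basis_in_T_module affine_orbit_translate
      free_vs.subspace_scale[OF T_module_subspace])

lemma perm_act_T_module: "t \<in> T_module \<beta> \<Longrightarrow> p \<in> Alt \<Longrightarrow> perm_act p t \<in> T_module \<beta>"
  unfolding perm_act_def by (auto intro!: lin_ext_T_module basis_in_T_module affine_orbit_perm)

lemma word_act_T_module: "t \<in> T_module \<beta> \<Longrightarrow> word_act w t \<in> T_module \<beta>"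
proof -
  assume "t \<in> T_module \<beta>"
  then have "foldr gen_act gs t \<in> T_module \<beta>" for gs
    by (induction gs) (simp_all add: gen_act_T_module)
  then show ?thesis by (simp add: word_act_def)
qed

lemma free_act_T_module: "t \<in> T_module \<beta> \<Longrightarrow> free_act f t \<in> T_module \<beta>"
  unfolding free_act_def lin_ext_def
  by (intro free_vs.subspace_sum[OF T_module_subspace] free_vs.subspace_scale[OF T_module_subspace]
      word_act_T_module)

lemma weyl_act_T_module: "t \<in> T_module \<beta> \<Longrightarrow> weyl_act w t \<in> T_module \<beta>"
  by transfer (rule free_act_T_module)

lemma perm_act_sum: "perm_act p (sum f I) = (\<Sum>i\<in>I. perm_act p (f i))"
  by (simp add: perm_act_def lin_ext_sum)

lemma weyl_act_sum_left: "weyl_act (sum f I) t = (\<Sum>i\<in>I. weyl_act (f i) t)"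
  by (induction I rule: infinite_finite_induct) (simp_all add: weyl_act_add_left)

lemma weyl_act_sum_right: "weyl_act w (sum f I) = (\<Sum>i\<in>I. weyl_act w (f i))"
  by (induction I rule: infinite_finite_induct) (simp_all add: weyl_act_add_right)

lemma skew_act_mult:
  "skew_act (a * b) t = skew_act a (skew_act b (t :: 'b::field ^ 'a::finite \<Rightarrow>\<^sub>0 'b))"
proof transfer
  fix a b :: "('a \<Rightarrow> 'a) \<Rightarrow> ('a, 'b) weyl" and t :: "'b ^ 'a \<Rightarrow>\<^sub>0 'b"
  have "(\<Sum>r\<in>Alt. weyl_act (\<Sum>p\<in>Alt. a p * weyl_perm p (b (inv p \<circ> r))) (perm_act r t))
      = (\<Sum>p\<in>Alt. \<Sum>r\<in>Alt. weyl_act (a p * weyl_perm p (b (inv p \<circ> r))) (perm_act r t))"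
    by (simp only: weyl_act_sum_left) (rule sum.swap)
  also have "\<dots> = (\<Sum>p\<in>Alt. \<Sum>q\<in>Alt. weyl_act (a p * weyl_perm p (b q)) (perm_act (p \<circ> q) t))"
  proof (rule sum.cong[OF refl])
    fix p :: "'a \<Rightarrow> 'a" assume p: "p \<in> Alt"
    have "inv p \<circ> (p \<circ> q) = q" for q :: "'a \<Rightarrow> 'a"
      using Alt_inj[OF p] by (simp add: o_assoc)
    then show "(\<Sum>r\<in>Alt. weyl_act (a p * weyl_perm p (b (inv p \<circ> r))) (perm_act r t))
        = (\<Sum>q\<in>Alt. weyl_act (a p * weyl_perm p (b q)) (perm_act (p \<circ> q) t))"
      by (subst sum.reindex_bij_betw[OF bij_betw_Alt_translate[OF p], symmetric])
        (simp del: o_apply)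
  qed
  also have "\<dots> = (\<Sum>p\<in>Alt. weyl_act (a p) (perm_act p (\<Sum>q\<in>Alt. weyl_act (b q) (perm_act q t))))"
    by (intro sum.cong)
      (simp_all del: o_apply add: perm_act_sum weyl_act_sum_right weyl_act_mult
        perm_act_weyl_act perm_act_compose Alt_bij)
  finally show "(\<Sum>r\<in>Alt. weyl_act (\<Sum>p\<in>Alt. a p * weyl_perm p (b (inv p \<circ> r))) (perm_act r t))
      = (\<Sum>p\<in>Alt. weyl_act (a p) (perm_act p (\<Sum>q\<in>Alt. weyl_act (b q) (perm_act q t))))" .
qed

lemma skew_of_weyl_one: "skew_of_weyl 1 = 1"
  by (rule skew_coeff_inject[THEN iffD1]) (simp add: one_skew_weyl.rep_eq)

lemma skew_vs: "vector_space (skew_scale :: 'k::field \<Rightarrow> ('i::finite, 'k) skew_weyl \<Rightarrow> _)"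
  by unfold_locales
    (rule skew_coeff_inject[THEN iffD1],
     simp add: fun_eq_iff skew_scale.rep_eq plus_skew_weyl.rep_eq
       weyl_vs.scale_right_distrib weyl_vs.scale_left_distrib)+

text \<open>\<open>T\<^sub>\<beta>\<close> is a module over the full skew group ring.\<close>

theorem T_module_skew:
  fixes \<beta> :: "'b::field ^ 'a::finite"
  shows "algebra_module skew_scale fscale UNIV (T_module \<beta>) skew_act"
proof -
  interpret skew: vector_space "skew_scale :: 'b \<Rightarrow> ('a, 'b) skew_weyl \<Rightarrow> _"
    by (rule skew_vs)
  show ?thesis
  proof
    fix a b :: "('a, 'b) skew_weyl" and c :: 'b and m m' :: "'b ^ 'a \<Rightarrow>\<^sub>0 'b"
    show "skew_scale c a * b = skew_scale c (a * b)"
      by (rule skew_coeff_inject[THEN iffD1])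
        (simp add: fun_eq_iff skew_scale.rep_eq times_skew_weyl.rep_eq weyl_scale_mult_left
          weyl_vs.scale_sum_right)
    show "a * skew_scale c b = skew_scale c (a * b)"
      by (rule skew_coeff_inject[THEN iffD1])
        (simp add: fun_eq_iff skew_scale.rep_eq times_skew_weyl.rep_eq weyl_scale_mult_right
          weyl_perm_scale Alt_inj weyl_vs.scale_sum_right)
    show "skew.subspace UNIV" by (simp add: skew.subspace_UNIV)
    show "free_vs.subspace (T_module \<beta>)" by (rule T_module_subspace)
    show "skew_act a m \<in> T_module \<beta>" if "m \<in> T_module \<beta>"
      unfolding skew_act.rep_eq
      by (intro free_vs.subspace_sum[OF T_module_subspace] weyl_act_T_module perm_act_T_module that)
    show "skew_act (a + b) m = skew_act a m + skew_act b m"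
      by (simp add: skew_act.rep_eq plus_skew_weyl.rep_eq weyl_act_add_left sum.distrib)
    show "skew_act a (m + m') = skew_act a m + skew_act a m'"
      by (simp add: skew_act.rep_eq weyl_act_add_right sum.distrib)
    show "skew_act (skew_scale c a) m = fscale c (skew_act a m)"
      by (simp add: skew_act.rep_eq skew_scale.rep_eq weyl_act_scale_left free_vs.scale_sum_right)
    show "skew_act a (fscale c m) = fscale c (skew_act a m)"
      by (simp add: skew_act.rep_eq weyl_act_scale_right free_vs.scale_sum_right)
    show "skew_act 1 m = m"
      by (simp flip: skew_of_weyl_one)
    show "skew_act (a * b) m = skew_act a (skew_act b m)"
      by (rule skew_act_mult)
  qed simp_all
qed

lemma skew_act_X: "skew_act (skew_of_weyl (wX i)) (basis v) = basis (v + axis i 1)"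
  by (simp add: weyl_act_wX)

lemma skew_act_Y:
  "skew_act (skew_of_weyl (wY i)) (basis v) = fscale (v $ i) (basis (v - axis i 1))"
  by (simp add: weyl_act_wY)

lemma skew_act_perm_basis:
  "p \<in> Alt \<Longrightarrow> skew_act (skew_of_perm p) (basis v) = basis (perm_vec p v)"
  by (simp add: perm_act_def)

end

theory Submission
  imports Defs
begin

text \<open>Write \<open>[v]\<close> for the sum of all \<open>T(p(v))\<close>, \<open>p\<close> an even permutation; these elements span the
  invariants. An element of the Weyl algebra that maps \<open>T(u)\<close> to \<open>T(v)\<close> and kills the other points
  of the orbit of \<open>u\<close> (polynomials in the \<open>x\<^sub>iy\<^sub>i\<close> separate points) averages to an invariant
  mapping \<open>[u]\<close> to a nonzero multiple of \<open>[v]\<close>. Hence \<open>[u]\<close> generates the module as soon as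
  \<open>T(u)\<close> generates the translates of \<open>u\<close>, for instance if every integral coordinate of \<open>u\<close> is \<open>-1\<close>.

  A fixed element of the algebra moves supports a bounded distance, so the growth is at most that
  of the lattice points in a box. Conversely choose \<open>v\<close> in the orbit and \<open>N > 0\<close> such that no
  difference of two coordinates of \<open>v\<close> is an integral multiple of \<open>N\<close>. By Lagrange interpolation
  in the eigenvalues of the \<open>x\<^sub>jy\<^sub>j\<close>, the invariants \<open>\<Sum>\<^sub>j x\<^sub>j\<^sup>N (x\<^sub>jy\<^sub>j)\<^sup>b\<close> with \<open>b < n\<close> reach in
  \<open>m\<close> steps from \<open>[v]\<close> all \<open>[v + N a]\<close> with \<open>a \<in> \<nat>\<^sup>n\<close> and \<open>|a| \<le> m\<close>, and these are independent.\<close>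

section \<open>Symmetrization\<close>

text \<open>The sum runs over the group rather than over the orbit, so each orbit point occurs with
  the order of its stabilizer as coefficient. This keeps all reindexing arguments free of case
  distinctions.\<close>

definition orbit_sum :: "'k ^ 'i::finite \<Rightarrow> ('k ^ 'i \<Rightarrow>\<^sub>0 'k::field)"
  where "orbit_sum v = (\<Sum>p\<in>Alt. basis (perm_vec p v))"

definition symmetrize :: "('k ^ 'i \<Rightarrow>\<^sub>0 'k) \<Rightarrow> ('k ^ 'i::finite \<Rightarrow>\<^sub>0 'k::field)"
  where "symmetrize t = (\<Sum>p\<in>Alt. perm_act p t)"

lemma perm_act_basis [simp]: "perm_act p (basis v) = basis (perm_vec p v)"
  by (simp add: perm_act_def)

lemma symmetrize_basis: "symmetrize (basis v) = orbit_sum v"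
  by (simp add: symmetrize_def orbit_sum_def)

lemma symmetrize_fscale: "symmetrize (fscale c t) = fscale c (symmetrize t)"
  by (simp add: symmetrize_def free_vs.scale_sum_right)

lemma symmetrize_sum: "symmetrize (sum f I) = (\<Sum>i\<in>I. symmetrize (f i))"
  by (simp add: symmetrize_def perm_act_sum) (rule sum.swap)

lemma perm_act_symmetrize:
  assumes "q \<in> Alt"
  shows "perm_act q (symmetrize t) = symmetrize t"
proof -
  have "perm_act q (symmetrize t) = (\<Sum>p\<in>Alt. perm_act (q \<circ> p) t)"
    using assms by (simp add: symmetrize_def perm_act_sum perm_act_compose Alt_bij del: o_apply)
  also have "\<dots> = symmetrize t"
    unfolding symmetrize_def
    by (rule sum.reindex_bij_betw[OF bij_betw_Alt_translate[OF assms]])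
  finally show ?thesis .
qed

lemma perm_act_orbit_sum: "q \<in> Alt \<Longrightarrow> perm_act q (orbit_sum v) = orbit_sum v"
  by (simp add: perm_act_symmetrize flip: symmetrize_basis)

text \<open>Right translation by \<open>q\<close> permutes the group. The lemma serves to replace
  any orbit point by a representative in the same \<open>\<int>\<close>-coset as the base
  point.\<close>

lemma orbit_sum_perm_vec:
  fixes v :: "'k::field ^ 'i::finite"
  assumes "q \<in> Alt"
  shows "orbit_sum (perm_vec q v) = orbit_sum v"
proof -
  have "bij_betw (\<lambda>p. p \<circ> q) Alt Alt"
  proof (rule bij_betwI[of _ _ _ "\<lambda>p. p \<circ> inv q"])
    show "(\<lambda>p. p \<circ> q) \<in> Alt \<rightarrow> Alt" "(\<lambda>p. p \<circ> inv q) \<in> Alt \<rightarrow> Alt"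
      using assms Alt_compose Alt_inv by blast+
    show "p \<circ> q \<circ> inv q = p" "p \<circ> inv q \<circ> q = p" for p :: "'i \<Rightarrow> 'i"
      using Alt_bij[OF assms] by (simp_all add: comp_assoc bij_is_inj bij_is_surj surj_iff[THEN iffD1])
  qed
  then have "orbit_sum v = (\<Sum>p\<in>Alt. basis (perm_vec (p \<circ> q) v))"
    unfolding orbit_sum_def by (rule sum.reindex_bij_betw[symmetric])
  also have "\<dots> = orbit_sum (perm_vec q v)"
    unfolding orbit_sum_def using assms by (simp add: perm_vec_compose Alt_bij del: o_apply)
  finally show ?thesis by simp
qed

lemma symmetrize_invariant:
  assumes "\<And>p. p \<in> Alt \<Longrightarrow> perm_act p t = t"
  shows "symmetrize (t :: 'k ^ 'i::finite \<Rightarrow>\<^sub>0 'k::field)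
    = fscale (of_nat (card (Alt :: ('i \<Rightarrow> 'i) set))) t"
proof -
  have "symmetrize t = (\<Sum>p\<in>(Alt :: ('i \<Rightarrow> 'i) set). t)"
    unfolding symmetrize_def by (intro sum.cong refl assms)
  then show ?thesis by (simp only: free_vs.sum_constant_scale)
qed

lemma poly_mapping_basis_expansion:
  "t = (\<Sum>v\<in>Poly_Mapping.keys t. fscale (Poly_Mapping.lookup t v) (basis v :: 'b \<Rightarrow>\<^sub>0 'k::field))"
  by (rule poly_mapping_eqI) (auto simp: lookup_sum lookup_single when_def in_keys_iff sum.delta)

lemma card_Alt_neq_0 [simp]:
  "of_nat (card (Alt :: ('i::finite \<Rightarrow> 'i) set)) \<noteq> (0 :: 'k::field_char_0)"
  using Alt_id by (auto simp: card_eq_0_iff simp del: Alt_id)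

text \<open>Symmetrizing multiplies an invariant by the group order, which is invertible in
  characteristic zero; symmetrizing its basis expansion term by term produces orbit sums.\<close>

lemma invariant_eq_orbit_sums:
  fixes t :: "'k ^ 'i::finite \<Rightarrow>\<^sub>0 'k::field_char_0"
  assumes "\<And>p. p \<in> Alt \<Longrightarrow> perm_act p t = t"
  shows "t = fscale (1 / of_nat (card (Alt :: ('i \<Rightarrow> 'i) set)))
      (\<Sum>v\<in>Poly_Mapping.keys t. fscale (Poly_Mapping.lookup t v) (orbit_sum v))"
proof -
  have "symmetrize t = (\<Sum>v\<in>Poly_Mapping.keys t. fscale (Poly_Mapping.lookup t v) (orbit_sum v))"
    by (subst (1) poly_mapping_basis_expansion[of t])
      (simp add: symmetrize_sum symmetrize_fscale symmetrize_basis del: fscale_single)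
  then show ?thesis
    using symmetrize_invariant[of t] assms by (metis (no_types, lifting) free_vs.scale_one free_vs.scale_scale
      card_Alt_neq_0 nonzero_eq_divide_eq)
qed

section \<open>The module of invariants\<close>

lemma T_invariants_iff:
  "t \<in> T_invariants \<beta> \<longleftrightarrow> t \<in> T_module \<beta> \<and> (\<forall>p\<in>Alt. perm_act p t = t)"
  by (simp add: T_invariants_def)

lemma T_invariants_subspace: "free_vs.subspace (T_invariants \<beta>)"
  using T_module_subspace[of \<beta>]
  by (auto simp: free_vs.subspace_def T_invariants_iff) (simp add: perm_act_def)

lemma orbit_sum_in_T_invariants:
  assumes "v \<in> affine_orbit \<beta>"
  shows "orbit_sum v \<in> T_invariants \<beta>"
proof -
  have "orbit_sum v \<in> T_module \<beta>"
    unfolding orbit_sum_def using assms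
    by (intro free_vs.subspace_sum[OF T_module_subspace] basis_in_T_module affine_orbit_perm)
  then show ?thesis by (simp add: T_invariants_iff perm_act_orbit_sum)
qed

lemma weyl_act_T_invariants:
  "w \<in> weyl_invariants \<Longrightarrow> t \<in> T_invariants \<beta> \<Longrightarrow> weyl_act w t \<in> T_invariants \<beta>"
  by (auto simp: T_invariants_iff weyl_invariants_def weyl_act_T_module perm_act_weyl_act Alt_bij)

lemma weyl_invariants_subspace:
  "weyl_vs.subspace (weyl_invariants :: ('i::finite, 'k::field) weyl set)"
  by (auto simp: weyl_vs.subspace_def weyl_invariants_def weyl_perm_add weyl_perm_scale Alt_inj)

lemma algebra_module_T_invariants:
  fixes \<beta> :: "'k::field ^ 'i::finite"
  shows "algebra_module weyl_scale fscale weyl_invariants (T_invariants \<beta>)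
    (\<lambda>w. skew_act (skew_of_weyl w))"
proof
  show "weyl_vs.subspace (weyl_invariants :: ('i, 'k) weyl set)"
    by (rule weyl_invariants_subspace)
  show "free_vs.subspace (T_invariants \<beta>)"
    by (rule T_invariants_subspace)
qed (auto simp: weyl_scale_mult_left weyl_scale_mult_right weyl_act_T_invariants weyl_act_add_left
    weyl_act_add_right weyl_act_scale_left weyl_act_scale_right weyl_act_mult
    weyl_invariants_def weyl_perm_mult Alt_inj)

section \<open>Averaging over the group\<close>

definition weyl_average :: "('i::finite, 'k::field) weyl \<Rightarrow> ('i, 'k) weyl"
  where "weyl_average w = (\<Sum>p\<in>Alt. weyl_perm p w)"

lemma weyl_average_invariant: "weyl_average w \<in> weyl_invariants"
proof -
  have "weyl_perm q (weyl_average w) = weyl_average w" if q: "q \<in> Alt" for q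
  proof -
    have "weyl_perm q (weyl_average w) = (\<Sum>p\<in>Alt. weyl_perm (q \<circ> p) w)"
      using q by (simp add: weyl_average_def weyl_perm_sum weyl_perm_compose Alt_inj del: o_apply)
    also have "\<dots> = weyl_average w"
      unfolding weyl_average_def
      by (rule sum.reindex_bij_betw[OF bij_betw_Alt_translate[OF q]])
    finally show ?thesis .
  qed
  then show ?thesis by (simp add: weyl_invariants_def)
qed

text \<open>For a fixed vector \<open>t\<close>, equivariance turns \<open>weyl_perm p w\<close>
  acting on \<open>t\<close> into \<open>perm_act p\<close> of \<open>weyl_act w t\<close>. So an
  arbitrary \<open>w\<close> yields an invariant operator whose effect on invariant vectors is
  known. No factor of the group order intervenes, as neither side is normalized.\<close>

lemma weyl_average_act:
  assumes "\<And>p. p \<in> Alt \<Longrightarrow> perm_act p t = t"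
  shows "weyl_act (weyl_average w) t = symmetrize (weyl_act w t)"
  by (simp add: weyl_average_def symmetrize_def weyl_act_sum_left perm_act_weyl_act Alt_bij assms)

text \<open>The same equivariance with the invariance on the side of the algebra: the effect on an
  orbit sum can be read off from a single basis vector.\<close>

lemma invariant_act_orbit_sum:
  assumes "w \<in> weyl_invariants"
  shows "weyl_act w (orbit_sum v) = symmetrize (weyl_act w (basis v))"
  using assms
  by (simp add: orbit_sum_def symmetrize_def weyl_act_sum_right perm_act_weyl_act Alt_bij
      weyl_invariants_def)


section \<open>Finite generation\<close>

lemma weyl_act_euler: "weyl_act (wX i * wY i) (basis v) = fscale (v $ i) (basis v)"
  by (simp add: weyl_act_mult weyl_act_wY weyl_act_wX weyl_act_scale_right del: fscale_single)

lemma separating_weyl_element: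
  fixes v :: "'k::field ^ 'i::finite"
  assumes "finite P" "v \<notin> P"
  shows "\<exists>w. weyl_act w (basis v) = basis v \<and> (\<forall>u\<in>P. weyl_act w (basis u) = 0)"
  using assms
proof (induction P)
  case empty
  show ?case by (auto intro!: exI[of _ 1])
next
  case (insert u P)
  then obtain w where w: "weyl_act w (basis v) = basis v" "\<forall>u\<in>P. weyl_act w (basis u) = 0"
    by auto
  from insert.prems have "u \<noteq> v" by auto
  then obtain i where i: "v $ i \<noteq> u $ i" by (metis vec_eq_iff)
  \<comment> \<open>A Lagrange factor in the Euler operator \<open>wX i * wY i\<close>, which is
    diagonal with eigenvalue \<open>r $ i\<close> at \<open>r\<close>: it is 1 at \<open>v\<close>,
    0 at \<open>u\<close> and a scalar at every other point, so the zeros of \<open>w\<close>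
    persist.\<close>
  let ?e = "weyl_scale (1 / (v $ i - u $ i)) (wX i * wY i - weyl_scale (u $ i) 1)"
  have e: "weyl_act ?e (basis r) = fscale ((r $ i - u $ i) / (v $ i - u $ i)) (basis r)" for r
  proof -
    have "weyl_act (wX i * wY i - weyl_scale (u $ i) 1) (basis r)
        = fscale (r $ i) (basis r) - fscale (u $ i) (basis r)"
      by (simp only: diff_conv_add_uminus weyl_act_add_left weyl_act_euler
          weyl_vs.scale_minus_left[symmetric] weyl_act_scale_left weyl_act_one free_vs.scale_minus_left)
    then show ?thesis
      by (simp add: weyl_act_scale_left del: fscale_single flip: free_vs.scale_left_diff_distrib)
  qed
  have "weyl_act (w * ?e) (basis v) = basis v"
    using i w by (simp add: weyl_act_mult e)
  moreover have "weyl_act (w * ?e) (basis r) = 0" if "r \<in> insert u P" for r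
    using w that by (auto simp: weyl_act_mult e weyl_act_scale_right simp del: fscale_single)
  ultimately show ?case by blast
qed

definition int_vec :: "int ^ 'i \<Rightarrow> 'k::field ^ 'i::finite"
  where "int_vec z = (\<chi> i. of_int (z $ i))"

text \<open>Lowering \<open>T(v)\<close> in direction \<open>i\<close> is obstructed exactly at \<open>v\<^sub>i = 0\<close>, which a point
  reached from \<open>u\<^sub>i = -1\<close> by lowering never meets.\<close>

lemma weyl_act_reaches:
  fixes u :: "'k::field_char_0 ^ 'i::finite"
  assumes u: "\<And>i. u $ i = -1 \<or> u $ i \<notin> \<int>"
  shows "\<exists>w. weyl_act w (basis u) = basis (u + int_vec z)"
proof -
  let ?C = "{v. \<exists>w. weyl_act w (basis u) = basis v}"
  have up: "v + axis i 1 \<in> ?C" if "v \<in> ?C" for v i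
  proof -
    from that obtain w where "weyl_act w (basis u) = basis v" by blast
    then have "weyl_act (wX i * w) (basis u) = basis (v + axis i 1)"
      by (simp add: weyl_act_mult weyl_act_wX)
    then show ?thesis by blast
  qed
  have down: "v - axis i 1 \<in> ?C" if "v \<in> ?C" "v $ i \<noteq> 0" for v i
  proof -
    from that obtain w where "weyl_act w (basis u) = basis v" by blast
    then have "weyl_act (weyl_scale (1 / v $ i) (wY i * w)) (basis u) = basis (v - axis i 1)"
      using that by (simp add: weyl_act_mult weyl_act_wY weyl_act_scale_left)
    then show ?thesis by blast
  qed
  have line: "v + axis i (of_int k) \<in> ?C" if v: "v \<in> ?C" "v $ i = u $ i" for v i k
  proof (induction k rule: int_induct[where k = 0])
    case base
    have "axis i (of_int 0) = (0 :: 'k ^ 'i)" by (simp add: axis_def vec_eq_iff)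
    then show ?case using v by (simp only: add_0_right)
  next
    case (step1 k)
    have "v + axis i (of_int (k + 1)) = v + axis i (of_int k) + axis i 1"
      by (simp add: axis_def vec_eq_iff)
    with up[OF step1(2)] show ?case by metis
  next
    case (step2 k)
    have "(v + axis i (of_int k)) $ i \<noteq> 0"
    proof
      assume "(v + axis i (of_int k)) $ i = 0"
      then have eq: "u $ i = of_int (- k)" by (simp add: v axis_def eq_neg_iff_add_eq_0)
      then have "u $ i = of_int (-1)" using u[of i] by auto
      with eq have "- k = -1" by (metis of_int_eq_iff)
      with step2(1) show False by simp
    qed
    moreover have "v + axis i (of_int (k - 1)) = v + axis i (of_int k) - axis i 1"
      by (simp add: axis_def vec_eq_iff)
    ultimately show ?case using down[OF step2(2)] by metis
  qed
  \<comment> \<open>Coordinates are moved one at a time: one outside \<open>J\<close> still has its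
    value in \<open>u\<close>, as \<open>line\<close> requires.\<close>
  have "u + (\<chi> i. if i \<in> J then of_int (z $ i) else 0) \<in> ?C" if "finite J" for J
    using that
  proof induction
    case empty
    have "(\<chi> i. 0) = (0 :: 'k ^ 'i)" by (simp add: vec_eq_iff)
    then show ?case by (auto intro!: exI[of _ 1])
  next
    case (insert j J)
    have "u + (\<chi> i. if i \<in> insert j J then of_int (z $ i) else 0)
        = u + (\<chi> i. if i \<in> J then of_int (z $ i) else 0) + axis j (of_int (z $ j))"
      using insert.hyps by (auto simp: vec_eq_iff axis_def)
    moreover have "u + (\<chi> i. if i \<in> J then of_int (z $ i) else 0) + axis j (of_int (z $ j)) \<in> ?C"
      using insert.hyps by (intro line[OF insert.IH]) simp
    ultimately show ?case by (simp only:)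
  qed
  from this[of UNIV] show ?thesis by (simp add: int_vec_def)
qed

lemma orbit_sum_reached:
  fixes u :: "'k::field_char_0 ^ 'i::finite"
  assumes "weyl_act w (basis u) = basis v"
  shows "\<exists>a\<in>weyl_invariants. weyl_act a (orbit_sum u) = orbit_sum v"
proof -
  let ?P = "(\<lambda>p. perm_vec p u) ` Alt - {u}"
  obtain e where e: "weyl_act e (basis u) = basis u" "\<forall>r\<in>?P. weyl_act e (basis r) = 0"
    using separating_weyl_element[of ?P u] by auto
  \<comment> \<open>The order of the stabilizer of \<open>u\<close>: exactly these terms of the
    orbit sum survive \<open>e\<close>. It contains the identity, hence is nonzero in characteristic
    zero.\<close>
  let ?s = "of_nat (card {p \<in> Alt. perm_vec p u = u}) :: 'k"
  have "id \<in> {p \<in> Alt. perm_vec p u = u}"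
    by (simp add: perm_vec_def)
  moreover have "finite {p \<in> Alt. perm_vec p u = u}" by simp
  ultimately have "card {p \<in> Alt. perm_vec p u = u} \<noteq> 0"
    using card_0_eq by blast
  then have s: "?s \<noteq> 0" by (simp only: of_nat_eq_0_iff not_False_eq_True)
  have "weyl_act e (orbit_sum u) = (\<Sum>p\<in>Alt. if perm_vec p u = u then basis u else 0)"
    unfolding orbit_sum_def weyl_act_sum_right using e by (intro sum.cong) auto
  also have "\<dots> = (\<Sum>p\<in>{p \<in> Alt. perm_vec p u = u}. basis u)"
    by (rule sum.inter_filter[symmetric]) simp
  also have "\<dots> = fscale ?s (basis u)"
    by (rule free_vs.sum_constant_scale)
  finally have "weyl_act (w * e) (orbit_sum u) = fscale ?s (basis v)"
    by (simp add: weyl_act_mult weyl_act_scale_right assms del: fscale_single)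
  then have "weyl_act (weyl_scale (1 / ?s) (w * e)) (orbit_sum u) = basis v"
    unfolding weyl_act_scale_left
    by (simp only: free_vs.scale_scale nonzero_divide_eq_eq[OF s] divide_self[OF s] mult_1
        times_divide_eq_left free_vs.scale_one)
  then have "weyl_act (weyl_average (weyl_scale (1 / ?s) (w * e))) (orbit_sum u) = orbit_sum v"
    by (simp add: weyl_average_act perm_act_orbit_sum symmetrize_basis)
  then show ?thesis using weyl_average_invariant by blast
qed

lemma affine_orbit_int_vec: "\<beta> + int_vec z \<in> affine_orbit \<beta>"
proof -
  have "\<beta> + int_vec z = perm_vec id \<beta> + (\<chi> i. of_int (z $ i))"
    by (simp add: int_vec_def perm_vec_def)
  then show ?thesis
    unfolding affine_orbit_def using Alt_id by blast
qed

lemma finitely_generated_T_invariants: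
  fixes \<beta> :: "'k::field_char_0 ^ 'i::finite"
  shows "finitely_generated_module weyl_invariants (T_invariants \<beta>) (\<lambda>w. skew_act (skew_of_weyl w))"
proof -
  define u :: "'k ^ 'i" where "u = (\<chi> i. if \<beta> $ i \<in> \<int> then -1 else \<beta> $ i)"
  have u: "u $ i = -1 \<or> u $ i \<notin> \<int>" for i by (simp add: u_def)
  have "\<exists>z. u = \<beta> + int_vec z"
  proof -
    have "\<exists>k. u $ i = \<beta> $ i + of_int k" for i
    proof (cases "\<beta> $ i \<in> \<int>")
      case True
      then obtain k where "\<beta> $ i = of_int k" by (auto elim: Ints_cases)
      then have "u $ i = \<beta> $ i + of_int (-1 - k)" by (simp add: u_def)
      then show ?thesis by blast
    next
      case False
      then have "u $ i = \<beta> $ i + of_int 0" by (simp add: u_def)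
      then show ?thesis by blast
    qed
    then obtain f where "\<And>i. u $ i = \<beta> $ i + of_int (f i)" by metis
    then have "u = \<beta> + int_vec (\<chi> i. f i)" by (simp add: vec_eq_iff int_vec_def)
    then show ?thesis by blast
  qed
  then obtain z0 where z0: "u = \<beta> + int_vec z0" ..
  then have "u \<in> affine_orbit \<beta>"
    by (simp add: affine_orbit_int_vec)
  then have gen: "orbit_sum u \<in> T_invariants \<beta>" by (rule orbit_sum_in_T_invariants)
  have orb: "\<exists>a\<in>weyl_invariants. weyl_act a (orbit_sum u) = orbit_sum v"
    if v: "v \<in> affine_orbit \<beta>" for v
  proof -
    from v obtain p z where p: "p \<in> Alt" and v: "v = perm_vec p \<beta> + int_vec z"
      unfolding affine_orbit_def int_vec_def by blast
    \<comment> \<open>Pulling \<open>p\<close> out in front leaves a translate of \<open>u\<close>,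
      which is reachable, while the orbit sum does not see \<open>p\<close>.\<close>
    have "v = perm_vec p (u + int_vec (perm_vec (inv p) z - z0))"
      using Alt_bij[OF p]
      by (simp add: v z0 perm_vec_def int_vec_def vec_eq_iff inv_inv_eq bij_is_surj surj_f_inv_f)
    then have "orbit_sum v = orbit_sum (u + int_vec (perm_vec (inv p) z - z0))"
      using orbit_sum_perm_vec[OF p] by simp
    then show ?thesis
      using weyl_act_reaches[OF u] orbit_sum_reached by metis
  qed
  \<comment> \<open>The cyclic submodule generated by \<open>orbit_sum u\<close>. As a subspace
    containing all orbit sums, it contains every invariant.\<close>
  let ?G = "{m. \<exists>a\<in>weyl_invariants. m = weyl_act a (orbit_sum u)}"
  have sub: "free_vs.subspace ?G"
  proof (rule free_vs.subspaceI)
    show "0 \<in> ?G"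
      using weyl_vs.subspace_0[OF weyl_invariants_subspace] by force
    show "x + y \<in> ?G" if "x \<in> ?G" "y \<in> ?G" for x y
      using that weyl_vs.subspace_add[OF weyl_invariants_subspace]
      by (force simp: weyl_act_add_left[symmetric])
    show "fscale c x \<in> ?G" if "x \<in> ?G" for c x
      using that weyl_vs.subspace_scale[OF weyl_invariants_subspace]
      by (force simp: weyl_act_scale_left[symmetric])
  qed
  have all: "m \<in> ?G" if m: "m \<in> T_invariants \<beta>" for m
  proof -
    have "fscale (1 / of_nat (card (Alt :: ('i \<Rightarrow> 'i) set)))
      (\<Sum>v\<in>Poly_Mapping.keys m. fscale (Poly_Mapping.lookup m v) (orbit_sum v)) \<in> ?G"
    proof (intro free_vs.subspace_scale[OF sub] free_vs.subspace_sum[OF sub])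
      fix v assume "v \<in> Poly_Mapping.keys m"
      then have "v \<in> affine_orbit \<beta>" using m by (auto simp: T_invariants_iff T_module_def)
      from orb[OF this] show "orbit_sum v \<in> ?G" by force
    qed
    moreover have "m = fscale (1 / of_nat (card (Alt :: ('i \<Rightarrow> 'i) set)))
        (\<Sum>v\<in>Poly_Mapping.keys m. fscale (Poly_Mapping.lookup m v) (orbit_sum v))"
      using m unfolding T_invariants_iff by (intro invariant_eq_orbit_sums) blast
    ultimately show ?thesis by (rule ssubst[where P = "\<lambda>x. x \<in> ?G", rotated])
  qed
  show ?thesis
    unfolding finitely_generated_module_def
  proof (intro exI[of _ "{orbit_sum u}"] conjI ballI)
    fix m assume "m \<in> T_invariants \<beta>"
    then obtain a where "a \<in> weyl_invariants" "m = weyl_act a (orbit_sum u)"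
      using all by blast
    then show "\<exists>c. (\<forall>s\<in>{orbit_sum u}. c s \<in> weyl_invariants) \<and>
        m = (\<Sum>s\<in>{orbit_sum u}. skew_act (skew_of_weyl (c s)) s)"
      by (intro exI[of _ "\<lambda>_. a"]) simp
  qed (use gen in auto)
qed


section \<open>Upper bound for the growth\<close>

definition int_box :: "nat \<Rightarrow> 'k::field ^ 'i::finite \<Rightarrow> ('k ^ 'i) set"
  where "int_box d v = {v + int_vec z | z. \<forall>i. \<bar>z $ i\<bar> \<le> int d}"

text \<open>A filtration by support: \<open>K\<close> collects the centres and \<open>d\<close> is
  the radius in the maximum norm.\<close>

definition box_span :: "('k::field ^ 'i::finite) set \<Rightarrow> nat \<Rightarrow> ('k ^ 'i \<Rightarrow>\<^sub>0 'k) set"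
  where "box_span K d = {t. Poly_Mapping.keys t \<subseteq> (\<Union>v\<in>K. int_box d v)}"

text \<open>Only an inequality, because over a general field distinct integer vectors may have the
  same image.\<close>

lemma card_int_box:
  "finite (int_box d (v :: 'k::field ^ 'i::finite))"
  "card (int_box d v) \<le> (2 * d + 1) ^ CARD('i)"
proof -
  let ?F = "PiE (UNIV :: 'i set) (\<lambda>_. {- int d..int d})"
  let ?f = "\<lambda>g. v + int_vec (\<chi> i. g i)"
  have sub: "int_box d v \<subseteq> ?f ` ?F"
  proof
    fix x assume "x \<in> int_box d v"
    then obtain z where z: "\<forall>i. \<bar>z $ i\<bar> \<le> int d" and x: "x = v + int_vec z"
      unfolding int_box_def by blast
    have "($) z \<in> ?F" using z by (auto simp: abs_le_iff minus_le_iff)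
    moreover have "x = ?f (($) z)" by (simp add: x)
    ultimately show "x \<in> ?f ` ?F" by blast
  qed
  have fin: "finite ?F" by (intro finite_PiE) simp_all
  then show "finite (int_box d v)" using sub finite_subset by blast
  have "card (int_box d v) \<le> card ?F"
    using sub fin card_image_le card_mono finite_imageI le_trans by meson
  also have "\<dots> = (2 * d + 1) ^ CARD('i)"
  proof -
    have "card {- int d..int d} = 2 * d + 1" by simp
    then show ?thesis by (simp only: card_PiE[OF finite_class.finite_UNIV] prod_constant)
  qed
  finally show "card (int_box d v) \<le> (2 * d + 1) ^ CARD('i)" .
qed

lemma int_box_mono: "d \<le> e \<Longrightarrow> int_box d v \<subseteq> int_box e v"
proof -
  assume "d \<le> e"
  then have "\<bar>k\<bar> \<le> int e" if "\<bar>k\<bar> \<le> int d" for k using that by linarith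
  then show ?thesis unfolding int_box_def by blast
qed

lemma box_span_mono: "d \<le> e \<Longrightarrow> box_span K d \<subseteq> box_span K e"
  unfolding box_span_def using int_box_mono by blast

lemma int_box_step:
  assumes "u \<in> int_box d v"
  shows "u + axis i 1 \<in> int_box (Suc d) v" "u - axis i 1 \<in> int_box (Suc d) v"
proof -
  obtain z where z: "\<forall>i. \<bar>z $ i\<bar> \<le> int d" and u: "u = v + int_vec z"
    using assms unfolding int_box_def by blast
  have eq: "u + axis i 1 = v + int_vec (z + axis i 1)" "u - axis i 1 = v + int_vec (z - axis i 1)"
    by (simp_all add: u vec_eq_iff axis_def int_vec_def)
  have "\<forall>j. \<bar>(z + axis i 1) $ j\<bar> \<le> int (Suc d)" "\<forall>j. \<bar>(z - axis i 1) $ j\<bar> \<le> int (Suc d)"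
  proof -
    have "\<bar>(z + axis i 1) $ j\<bar> \<le> int (Suc d) \<and> \<bar>(z - axis i 1) $ j\<bar> \<le> int (Suc d)" for j
      using z[rule_format, of j] by (cases "j = i") (auto simp: axis_def)
    then show "\<forall>j. \<bar>(z + axis i 1) $ j\<bar> \<le> int (Suc d)" "\<forall>j. \<bar>(z - axis i 1) $ j\<bar> \<le> int (Suc d)"
      by blast+
  qed
  then show "u + axis i 1 \<in> int_box (Suc d) v" "u - axis i 1 \<in> int_box (Suc d) v"
    unfolding eq int_box_def by blast+
qed

lemma box_span_subspace: "free_vs.subspace (box_span K d)"
proof (rule free_vs.subspaceI)
  show "0 \<in> box_span K d" by (simp add: box_span_def)
  show "t + u \<in> box_span K d" if "t \<in> box_span K d" "u \<in> box_span K d" for t u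
    using that keys_add[of t u] unfolding box_span_def by blast
  show "fscale c t \<in> box_span K d" if "t \<in> box_span K d" for c t
    using that unfolding box_span_def by (auto simp: in_keys_iff)
qed

lemma lin_ext_box_span:
  assumes "t \<in> box_span K d" "\<And>u. u \<in> (\<Union>v\<in>K. int_box d v) \<Longrightarrow> \<phi> u \<in> box_span K e"
  shows "lin_ext \<phi> t \<in> box_span K e"
  unfolding lin_ext_def
proof (intro free_vs.subspace_sum[OF box_span_subspace] free_vs.subspace_scale[OF box_span_subspace])
  fix u assume "u \<in> Poly_Mapping.keys t"
  with assms show "\<phi> u \<in> box_span K e" unfolding box_span_def by blast
qed

lemma gen_act_box_span: "t \<in> box_span K d \<Longrightarrow> gen_act g t \<in> box_span K (Suc d)"
proof -
  assume t: "t \<in> box_span K d"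
  have "basis (u + axis i 1) \<in> box_span K (Suc d)" "basis (u - axis i 1) \<in> box_span K (Suc d)"
    if "u \<in> (\<Union>v\<in>K. int_box d v)" for u i
    using that int_box_step unfolding box_span_def by fastforce+
  then show ?thesis
    by (cases g) (simp_all only: gen_act.simps, (intro lin_ext_box_span[OF t]
        free_vs.subspace_scale[OF box_span_subspace], blast)+)
qed

lemma word_act_box_span:
  "t \<in> box_span K d \<Longrightarrow> word_act w t \<in> box_span K (d + length (letters w))"
proof -
  assume "t \<in> box_span K d"
  then have "foldr gen_act gs t \<in> box_span K (d + length gs)" for gs
    by (induction gs) (simp_all add: gen_act_box_span)
  then show ?thesis by (simp add: word_act_def)
qed

text \<open>Each letter enlarges the radius by one, and only finitely many words occur. The shift
  \<open>e\<close> is uniform in \<open>d\<close> and \<open>t\<close>, so iteration gives linear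
  growth of the radius.\<close>

lemma free_act_box_span:
  "\<exists>e. \<forall>d. \<forall>t\<in>box_span K d. free_act f t \<in> box_span K (d + e)"
proof -
  let ?e = "\<Sum>w\<in>Poly_Mapping.keys f. length (letters w)"
  have "word_act w t \<in> box_span K (d + ?e)"
    if "w \<in> Poly_Mapping.keys f" "t \<in> box_span K d" for w t d
  proof -
    have "length (letters w) \<le> ?e"
      using that(1) by (intro member_le_sum) simp_all
    then show ?thesis
      using word_act_box_span[OF that(2), of w] box_span_mono[of "d + length (letters w)" "d + ?e" K]
      by auto
  qed
  then have "free_act f t \<in> box_span K (d + ?e)" if "t \<in> box_span K d" for t d
    unfolding free_act_def lin_ext_def using that
    by (intro free_vs.subspace_sum[OF box_span_subspace] free_vs.subspace_scale[OF box_span_subspace])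
  then show ?thesis by blast
qed

lemma weyl_act_box_span:
  "\<exists>e. \<forall>d. \<forall>t\<in>box_span K d. weyl_act w t \<in> box_span K (d + e)"
  by transfer (rule free_act_box_span)

lemma finite_dim_act_box_span:
  assumes "finite_dim_subspace weyl_scale V"
  shows "\<exists>e. \<forall>w\<in>V. \<forall>d. \<forall>t\<in>box_span K d. weyl_act w t \<in> box_span K (d + e)"
proof -
  obtain B where B: "finite B" "V = weyl_vs.span B"
    using assms unfolding finite_dim_subspace_def by blast
  obtain e where e: "\<And>w d t. t \<in> box_span K d \<Longrightarrow> weyl_act w t \<in> box_span K (d + e w)"
    using weyl_act_box_span[of K] by metis
  have B_le: "weyl_act w t \<in> box_span K (d + sum e B)" if "w \<in> B" "t \<in> box_span K d" for w t d
  proof -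
    have "e w \<le> sum e B" using that B by (intro member_le_sum) simp_all
    then show ?thesis
      using e[OF that(2), of w] box_span_mono[of "d + e w" "d + sum e B" K] by auto
  qed
  have "weyl_act w t \<in> box_span K (d + sum e B)" if w: "w \<in> V" and t: "t \<in> box_span K d" for w t d
    using w unfolding B(2)
  proof (induction rule: weyl_vs.span_induct_alt)
    case base
    show ?case using free_vs.subspace_0[OF box_span_subspace] by simp
  next
    case (step c x y)
    then show ?case
      using B_le[OF step(1) t]
      by (simp add: weyl_act_add_left weyl_act_scale_left free_vs.subspace_add[OF box_span_subspace]
          free_vs.subspace_scale[OF box_span_subspace])
  qed
  then show ?thesis by blast
qed

text \<open>The supports of a finite spanning set serve as centres, so radius 0 suffices.\<close>

lemma finite_dim_subset_box_span:
  assumes "finite_dim_subspace fscale F"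
  shows "\<exists>K. finite K \<and> F \<subseteq> box_span K 0"
proof -
  obtain B where B: "finite B" "F = free_vs.span B"
    using assms unfolding finite_dim_subspace_def by blast
  let ?K = "\<Union>b\<in>B. Poly_Mapping.keys b"
  have "v \<in> int_box 0 v" for v :: "'a ^ 'b"
    unfolding int_box_def by (auto intro!: exI[of _ 0] simp: int_vec_def vec_eq_iff)
  then have "B \<subseteq> box_span ?K 0" unfolding box_span_def by fastforce
  then have "F \<subseteq> box_span ?K 0"
    unfolding B(2) by (intro free_vs.span_minimal box_span_subspace)
  moreover have "finite ?K" using B(1) by simp
  ultimately show ?thesis by blast
qed

text \<open>A finite spanning set is recorded instead of a bound on \<open>dim\<close>, since finite
  dimensionality itself is needed again for the lower bound.\<close>

lemma dim_box_span:
  fixes K :: "('k::field ^ 'i::finite) set"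
  assumes "finite K" "S \<subseteq> box_span K d"
  shows "\<exists>B. finite B \<and> S \<subseteq> free_vs.span B \<and> card B \<le> card K * (2 * d + 1) ^ CARD('i)"
proof -
  let ?Q = "\<Union>v\<in>K. int_box d v"
  let ?B = "basis ` ?Q :: ('k ^ 'i \<Rightarrow>\<^sub>0 'k) set"
  have fin: "finite ?Q" using assms(1) card_int_box by blast
  have "S \<subseteq> free_vs.span ?B"
  proof
    fix t assume "t \<in> S"
    then have t: "Poly_Mapping.keys t \<subseteq> ?Q" using assms(2) by (auto simp: box_span_def)
    show "t \<in> free_vs.span ?B"
      by (subst poly_mapping_basis_expansion[of t], intro free_vs.span_sum free_vs.span_scale
          free_vs.span_base) (use t in blast)
  qed
  moreover have "card ?B \<le> card K * (2 * d + 1) ^ CARD('i)"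
  proof -
    have "card ?B \<le> card ?Q" using fin by (rule card_image_le)
    also have "\<dots> \<le> (\<Sum>v\<in>K. card (int_box d v))"
      using assms(1) by (rule card_UN_le)
    also have "\<dots> \<le> (\<Sum>v\<in>K. (2 * d + 1) ^ CARD('i))"
      by (intro sum_mono card_int_box)
    finally show ?thesis by simp
  qed
  ultimately show ?thesis using fin by blast
qed

lemma power_space_box_span:
  assumes V: "\<And>w d t. w \<in> V \<Longrightarrow> t \<in> box_span K d \<Longrightarrow> weyl_act w t \<in> box_span K (d + e)"
    and F: "F \<subseteq> box_span K 0"
  shows "power_space fscale weyl_act V F m \<subseteq> box_span K (m * e)"
proof (induction m)
  case 0
  then show ?case using F by simp
next
  case (Suc m)
  have "{weyl_act v u | v u. v \<in> V \<and> u \<in> power_space fscale weyl_act V F m} \<subseteq> box_span K (Suc m * e)"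
    using V[of _ _ "m * e"] Suc by (auto simp: add.commute)
  then show ?case
    by (simp only: power_space.simps) (intro free_vs.span_minimal box_span_subspace)
qed

lemma power_space_spanned:
  fixes V :: "('i::finite, 'k::field) weyl set"
  assumes "finite_dim_subspace weyl_scale V" "finite_dim_subspace fscale F"
  shows "\<exists>C>0. \<forall>m\<ge>1. \<exists>B. finite B \<and> power_space fscale weyl_act V F m \<subseteq> free_vs.span B
    \<and> real (card B) \<le> C * real m ^ CARD('i)"
proof -
  obtain K where K: "finite K" "F \<subseteq> box_span K 0"
    using finite_dim_subset_box_span[OF assms(2)] by blast
  obtain e where e: "\<And>w d t. w \<in> V \<Longrightarrow> t \<in> box_span K d \<Longrightarrow> weyl_act w t \<in> box_span K (d + e)"
    using finite_dim_act_box_span[OF assms(1), of K] by blast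
  \<comment> \<open>Adding 1 to \<open>card K\<close> keeps the constant positive even when there
    are no centres.\<close>
  let ?C = "(real (card K) + 1) * (2 * real e + 1) ^ CARD('i)"
  have "\<exists>B. finite B \<and> power_space fscale weyl_act V F m \<subseteq> free_vs.span B
      \<and> real (card B) \<le> ?C * real m ^ CARD('i)" if m: "m \<ge> 1" for m
  proof -
    obtain B where B: "finite B" "power_space fscale weyl_act V F m \<subseteq> free_vs.span B"
      "card B \<le> card K * (2 * (m * e) + 1) ^ CARD('i)"
      using dim_box_span[OF K(1) power_space_box_span[OF e K(2)]] by blast
    have "real (card B) \<le> real (card K) * (2 * (real m * real e) + 1) ^ CARD('i)"
      using of_nat_mono[OF B(3), where 'a = real] by (simp add: add.commute)
    \<comment> \<open>For \<open>m \<ge> 1\<close> the additive 1 inside the power is absorbed into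
      a multiple of \<open>m\<close>.\<close>
    also have "\<dots> \<le> (real (card K) + 1) * ((2 * real e + 1) * real m) ^ CARD('i)"
      using m by (intro mult_mono power_mono) (simp_all add: algebra_simps)
    also have "\<dots> = ?C * real m ^ CARD('i)"
      by (simp add: power_mult_distrib)
    finally show ?thesis using B by blast
  qed
  moreover have "?C > 0" by (simp add: add_nonneg_pos)
  ultimately show ?thesis by blast
qed


section \<open>Lower bound for the growth\<close>

lemma diff_eq_diff_if_add_eq_add: "a + c = b + d \<Longrightarrow> a - b = d - (c :: 'a::ab_group_add)"
  by (simp only: diff_eq_eq diff_add_eq eq_diff_eq) (simp only: add.commute)

lemma finite_if_subsingleton:
  assumes "\<And>x y. x \<in> A \<Longrightarrow> y \<in> A \<Longrightarrow> x = y"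
  shows "finite A"
proof (cases "A = {}")
  case False
  then obtain a where "a \<in> A" by blast
  with assms have "A \<subseteq> {a}" by (metis insertI1 subsetI)
  then show ?thesis by (rule finite_subset) simp
qed simp

text \<open>Translate along the line spanned by an integer vector \<open>r\<close> with distinct
  entries. Each pair of indices excludes at most one parameter \<open>t\<close>, and there are
  infinitely many integers.\<close>

lemma exists_distinct_translate:
  fixes \<beta> :: "'k::field_char_0 ^ 'i::finite"
  shows "\<exists>z. \<forall>i j. i \<noteq> j \<longrightarrow> (\<beta> + int_vec z) $ i \<noteq> (\<beta> + int_vec z) $ j"
proof -
  obtain r :: "'i \<Rightarrow> nat" where r: "inj r"
    using finite_imp_inj_to_nat_seg[of "UNIV :: 'i set"] by auto
  let ?bad = "\<Union>i. \<Union>j\<in>-{i}. {t. \<beta> $ i + of_int (t * int (r i)) = \<beta> $ j + of_int (t * int (r j))}"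
  have "finite {t. \<beta> $ i + of_int (t * int (r i)) = \<beta> $ j + of_int (t * int (r j))}"
    if "j \<in> - {i}" for i j
  proof (rule finite_if_subsingleton, clarify)
    fix s t :: int
    assume s: "\<beta> $ i + of_int (s * int (r i)) = \<beta> $ j + of_int (s * int (r j))"
      and t: "\<beta> $ i + of_int (t * int (r i)) = \<beta> $ j + of_int (t * int (r j))"
    have "of_int (s * int (r j) - s * int (r i)) = (of_int (t * int (r j) - t * int (r i)) :: 'k)"
      using diff_eq_diff_if_add_eq_add[OF s] diff_eq_diff_if_add_eq_add[OF t]
      by (simp only: of_int_diff)
    then have "s * int (r j) - s * int (r i) = t * int (r j) - t * int (r i)"
      by (simp only: of_int_eq_iff)
    then have "(s - t) * (int (r i) - int (r j)) = 0" by (simp add: algebra_simps)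
    moreover have "r i \<noteq> r j" using that r by (auto simp: inj_eq)
    ultimately show "s = t" by simp
  qed
  then have "finite ?bad" by (intro finite_UN_I finite)
  from ex_new_if_finite[OF infinite_UNIV_int this] obtain t where t: "t \<notin> ?bad" ..
  show ?thesis
    by (rule exI[of _ "\<chi> i. t * int (r i)"]) (use t in \<open>auto simp: int_vec_def\<close>)
qed

text \<open>Once the coordinates are distinct, finitely many nonzero integers occur as their
  differences, and any \<open>N\<close> exceeding all of these in absolute value has no nonzero
  multiple among them.\<close>

lemma exists_noncongruent_translate:
  fixes \<beta> :: "'k::field_char_0 ^ 'i::finite"
  shows "\<exists>z N. N > 0 \<and> (\<forall>i j k. i \<noteq> j \<longrightarrow>
    (\<beta> + int_vec z) $ i - (\<beta> + int_vec z) $ j \<noteq> of_int (int N * k))"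
proof -
  obtain z where z: "\<And>i j. i \<noteq> j \<Longrightarrow> (\<beta> + int_vec z) $ i \<noteq> (\<beta> + int_vec z) $ j"
    using exists_distinct_translate by blast
  let ?D = "\<Union>i j. {k :: int. (\<beta> + int_vec z) $ i - (\<beta> + int_vec z) $ j = of_int k}"
  have "finite {k :: int. d = of_int k}" for d :: 'k
    by (rule finite_if_subsingleton) (metis mem_Collect_eq of_int_eq_iff)
  then have fin: "finite ?D" by (intro finite_UN_I finite)
  \<comment> \<open>The sum is a crude substitute for the maximum; \<open>Suc\<close> makes the
    bound strict and \<open>N\<close> positive.\<close>
  define N where "N = Suc (\<Sum>k\<in>?D. nat \<bar>k\<bar>)"
  have "(\<beta> + int_vec z) $ i - (\<beta> + int_vec z) $ j \<noteq> of_int (int N * k)" if ij: "i \<noteq> j" for i j k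
  proof
    assume eq: "(\<beta> + int_vec z) $ i - (\<beta> + int_vec z) $ j = of_int (int N * k)"
    then have "int N * k \<in> ?D" by blast
    then have "nat \<bar>int N * k\<bar> \<le> (\<Sum>k\<in>?D. nat \<bar>k\<bar>)"
      using fin by (intro member_le_sum) auto
    moreover have "nat \<bar>int N * k\<bar> = N * nat \<bar>k\<bar>"
      by (simp add: abs_mult nat_mult_distrib)
    ultimately have "N * nat \<bar>k\<bar> < N" unfolding N_def by linarith
    then have "k = 0" by (cases "nat \<bar>k\<bar>") auto
    with eq z[OF ij] show False by simp
  qed
  moreover have "N > 0" by (simp add: N_def)
  ultimately show ?thesis by blast
qed

text \<open>The degree bound is the same for all \<open>v\<close>; this lets one finite-dimensional
  space of operators serve at every point.\<close>

lemma lagrange_basis_poly: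
  fixes v :: "'k::field ^ 'i::finite"
  assumes "inj (($) v)"
  shows "\<exists>q. degree q < CARD('i) \<and> poly q (v $ i) = 1 \<and> (\<forall>j. j \<noteq> i \<longrightarrow> poly q (v $ j) = 0)"
proof -
  let ?P = "\<Prod>j\<in>UNIV - {i}. [:- (v $ j), 1:]"
  have "poly ?P (v $ i) \<noteq> 0"
    using assms by (auto simp: poly_prod inj_eq)
  moreover have "poly ?P (v $ j) = 0" if "j \<noteq> i" for j
    using that by (auto simp: poly_prod)
  moreover have "degree ?P \<le> (\<Sum>j\<in>UNIV - {i}. degree [:- (v $ j), 1:])"
    using degree_prod_sum_le[of "UNIV - {i}" "\<lambda>j. [:- (v $ j), 1:]"] by (simp add: o_def)
  then have "degree ?P \<le> CARD('i) - 1"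
    by (simp add: card_Diff_singleton)
  then have "degree ?P < CARD('i)"
    using zero_less_card_finite[where 'a = 'i] by linarith
  ultimately show ?thesis
    by (intro exI[of _ "smult (1 / poly ?P (v $ i)) ?P"]) simp
qed

section \<open>Raising operators\<close>

definition raising :: "nat \<Rightarrow> nat \<Rightarrow> ('i::finite, 'k::field) weyl"
  where "raising N b = (\<Sum>j\<in>UNIV. wX j ^ N * (wX j * wY j) ^ b)"

lemma weyl_perm_power: "inj p \<Longrightarrow> weyl_perm p (w ^ b) = weyl_perm p w ^ b"
  by (induction b) (simp_all add: weyl_perm_mult)

lemma raising_invariant: "(raising N b :: ('i::finite, 'k::field) weyl) \<in> weyl_invariants"
proof -
  have "weyl_perm p (raising N b :: ('i, 'k) weyl) = raising N b" if p: "p \<in> Alt" for p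
    using sum.reindex_bij_betw[OF Alt_bij[OF p], of "\<lambda>j. wX j ^ N * (wX j * wY j) ^ b"]
    by (simp add: raising_def weyl_perm_sum weyl_perm_mult weyl_perm_power Alt_inj[OF p])
  then show ?thesis by (simp add: weyl_invariants_def)
qed

text \<open>The Euler factor stands on the right and acts first, so the coefficients are powers of
  the coordinates before the shift.\<close>

lemma weyl_act_raising:
  fixes v :: "'k::field ^ 'i::finite"
  shows "weyl_act (raising N b) (basis v)
    = (\<Sum>j\<in>UNIV. fscale ((v $ j) ^ b) (basis (v + axis j (of_nat N))))"
proof -
  have y: "weyl_act ((wX j * wY j) ^ b) (basis v) = fscale ((v $ j) ^ b) (basis v)" for j
    by (induction b) (simp_all add: weyl_act_mult[of "wX j * wY j"] weyl_act_euler
        weyl_act_scale_right mult.commute del: fscale_single)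
  have x: "weyl_act (wX j ^ N) (basis v) = basis (v + axis j (of_nat N))" for j
  proof (induction N)
    case 0
    have "v + axis j (of_nat 0) = v" by (simp add: axis_def vec_eq_iff)
    then show ?case by (simp only: power_0 weyl_act_one)
  next
    case (Suc N)
    have "v + axis j (of_nat N) + axis j 1 = v + axis j (of_nat (Suc N))"
      by (simp add: axis_def vec_eq_iff)
    with Suc show ?case by (simp only: power_Suc weyl_act_mult weyl_act_wX)
  qed
  show ?thesis
    by (simp add: raising_def weyl_act_sum_left weyl_act_mult y x weyl_act_scale_right del: fscale_single)
qed

text \<open>The unit makes the space admissible in \<open>GK_dim\<close> and allows idle steps in
  its powers.\<close>

definition raising_space :: "nat \<Rightarrow> ('i::finite, 'k::field) weyl set"
  where "raising_space N = weyl_vs.span (insert 1 (raising N ` {..<CARD('i)}))"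

text \<open>For distinct coordinates \<open>v\<^sub>j\<close>, Lagrange interpolation isolates a single summand of
  the action of the \<open>raising N b\<close> on \<open>v\<close>.\<close>

lemma raising_space_single_step:
  fixes v :: "'k::field ^ 'i::finite"
  assumes "inj (($) v)"
  shows "\<exists>w\<in>raising_space N. weyl_act w (orbit_sum v) = orbit_sum (v + axis i (of_nat N))"
proof -
  obtain q where q: "degree q < CARD('i)" "poly q (v $ i) = 1"
    "\<And>j. j \<noteq> i \<Longrightarrow> poly q (v $ j) = 0"
    using lagrange_basis_poly[OF assms, of i] by blast
  let ?w = "\<Sum>b\<le>degree q. weyl_scale (coeff q b) (raising N b) :: ('i, 'k) weyl"
  have "?w \<in> raising_space N"
    unfolding raising_space_def using q(1)
    by (intro weyl_vs.span_sum weyl_vs.span_scale weyl_vs.span_base) auto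
  moreover have "weyl_act ?w (basis v) = basis (v + axis i (of_nat N))"
  proof -
    have "weyl_act ?w (basis v) = (\<Sum>b\<le>degree q. \<Sum>j\<in>UNIV.
        fscale (coeff q b * (v $ j) ^ b) (basis (v + axis j (of_nat N))))"
      by (simp add: weyl_act_sum_left weyl_act_scale_left weyl_act_raising free_vs.scale_sum_right
          del: fscale_single)
    also have "\<dots> = (\<Sum>j\<in>UNIV. fscale (poly q (v $ j)) (basis (v + axis j (of_nat N))))"
      \<comment> \<open>With the sum over \<open>b\<close> innermost, the coefficient at each
        \<open>j\<close> becomes the value of \<open>q\<close> at \<open>v $ j\<close>.\<close>
      by (subst sum.swap) (simp add: poly_altdef free_vs.scale_sum_left del: fscale_single)
    also have "\<dots> = (\<Sum>j\<in>UNIV. if j = i then basis (v + axis j (of_nat N)) else 0)"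
      by (intro sum.cong) (auto simp: q)
    finally show ?thesis by simp
  qed
  moreover have "?w \<in> weyl_invariants"
    by (intro weyl_vs.subspace_sum[OF weyl_invariants_subspace]
        weyl_vs.subspace_scale[OF weyl_invariants_subspace] raising_invariant)
  ultimately show ?thesis
    using invariant_act_orbit_sum[of ?w v] by (auto simp: symmetrize_basis)
qed

lemma power_space_act:
  assumes "w \<in> V" "t \<in> power_space fscale act V F m"
  shows "act w t \<in> power_space fscale act V F (Suc m)"
  unfolding power_space.simps by (rule free_vs.span_base) (use assms in blast)

lemma raising_power_space:
  fixes v :: "'k::field_char_0 ^ 'i::finite"
  assumes noncong: "\<And>i j k. i \<noteq> j \<Longrightarrow> v $ i - v $ j \<noteq> of_int (int N * k)"
  shows "sum a UNIV \<le> m \<Longrightarrow>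
    orbit_sum (v + int_vec (\<chi> i. int (N * a i)))
      \<in> power_space fscale weyl_act (raising_space N) (free_vs.span {orbit_sum v}) m"
proof (induction m arbitrary: a)
  case 0
  then have "v + int_vec (\<chi> i. int (N * a i)) = v" by (simp add: int_vec_def vec_eq_iff)
  then show ?case by (simp add: free_vs.span_base)
next
  case (Suc m)
  let ?P = "power_space fscale weyl_act (raising_space N) (free_vs.span {orbit_sum v}) m"
  show ?case
  proof (cases "sum a UNIV \<le> m")
    case True
    have "1 \<in> raising_space N" unfolding raising_space_def by (intro weyl_vs.span_base) simp
    from power_space_act[OF this Suc.IH[OF True]] show ?thesis by (simp only: weyl_act_one)
  next
    case False
    then have "sum a UNIV \<noteq> 0" by linarith
    then obtain i where i: "a i \<noteq> 0" by (metis sum.neutral)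
    define a' where "a' = a(i := a i - 1)"
    have "sum a UNIV = a i + sum a (UNIV - {i})" "sum a' UNIV = a' i + sum a' (UNIV - {i})"
      by (simp_all add: sum.remove)
    moreover have "sum a' (UNIV - {i}) = sum a (UNIV - {i})"
      by (intro sum.cong) (auto simp: a'_def)
    ultimately have "sum a' UNIV \<le> m" using Suc.prems i by (simp add: a'_def)
    note IH = Suc.IH[OF this]
    let ?u = "v + int_vec (\<chi> i. int (N * a' i))"
    \<comment> \<open>Moving by multiples of \<open>N\<close> preserves incongruence modulo
      \<open>N\<close>, so all intermediate points have distinct coordinates and interpolation stays
      available.\<close>
    have "inj (($) ?u)"
    proof (rule injI, rule ccontr)
      fix j l assume "j \<noteq> l" and "?u $ j = ?u $ l"
      then have "v $ j + of_int (int N * int (a' j)) = v $ l + of_int (int N * int (a' l))"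
        by (simp add: int_vec_def)
      then have "v $ j - v $ l = of_int (int N * (int (a' l) - int (a' j)))"
        by (simp only: diff_eq_diff_if_add_eq_add of_int_diff right_diff_distrib)
      with noncong[OF \<open>j \<noteq> l\<close>] show False by blast
    qed
    then obtain w where w: "w \<in> raising_space N"
      "weyl_act w (orbit_sum ?u) = orbit_sum (?u + axis i (of_nat N))"
      using raising_space_single_step by blast
    have "?u + axis i (of_nat N) = v + int_vec (\<chi> i. int (N * a i))"
    proof -
      have "of_nat (a i) = (1 + of_nat (a' i) :: 'k)" using i by (simp add: a'_def of_nat_diff)
      then show ?thesis
        by (auto simp: vec_eq_iff int_vec_def axis_def algebra_simps) (simp add: a'_def)
    qed
    with power_space_act[OF w(1) IH] w(2) show ?thesis by (simp only:)
  qed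
qed

section \<open>Linear independence\<close>

lemma inj_on_independent_by_evaluation:
  assumes "\<And>a. a \<in> I \<Longrightarrow> Poly_Mapping.lookup (f a) (g a) \<noteq> (0 :: 'k::field)"
    and "\<And>a b. a \<in> I \<Longrightarrow> b \<in> I \<Longrightarrow> a \<noteq> b \<Longrightarrow> Poly_Mapping.lookup (f a) (g b) = 0"
  shows "inj_on f I" "free_vs.independent (f ` I)"
proof -
  show inj: "inj_on f I"
    using assms by (metis inj_onI)
  show "free_vs.independent (f ` I)"
    unfolding free_vs.independent_explicit_finite_subsets
  proof (intro allI impI ballI)
    fix A u x
    assume A: "A \<subseteq> f ` I" "finite A" and 0: "(\<Sum>v\<in>A. fscale (u v) v) = 0" and "x \<in> A"
    then obtain a where a: "a \<in> I" "x = f a" by blast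
    \<comment> \<open>The coefficient at \<open>g a\<close> vanishes on every member of the family
      except \<open>f a\<close>.\<close>
    have "0 = (\<Sum>v\<in>A. u v * Poly_Mapping.lookup v (g a))"
      using arg_cong[OF 0, of "\<lambda>t. Poly_Mapping.lookup t (g a)"] by (simp add: lookup_sum)
    also have "\<dots> = (\<Sum>v\<in>A. if v = x then u x * Poly_Mapping.lookup x (g a) else 0)"
    proof (intro sum.cong refl)
      fix y assume "y \<in> A"
      then obtain b where "b \<in> I" "y = f b" using A by blast
      then show "u y * Poly_Mapping.lookup y (g a) = (if y = x then u x * Poly_Mapping.lookup x (g a) else 0)"
        using assms(2)[of b a] a by auto
    qed
    also have "\<dots> = u x * Poly_Mapping.lookup x (g a)" using A \<open>x \<in> A\<close> by simp
    finally show "u x = 0" using assms(1) a by simp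
  qed
qed

lemma lookup_orbit_sum:
  "Poly_Mapping.lookup (orbit_sum v) u = of_nat (card {p \<in> Alt. perm_vec p v = u})"
  by (simp add: orbit_sum_def lookup_sum lookup_single when_def sum.inter_filter[symmetric])

text \<open>A nontrivial permutation carrying one lattice point to another would make two distinct
  coordinates of \<open>v\<close> congruent modulo \<open>N\<close>. Hence stabilizers are trivial
  and orbits disjoint, so evaluation at the points themselves gives the identity matrix.\<close>

lemma independent_orbit_sums:
  fixes v :: "'k::field_char_0 ^ 'i::finite"
  assumes noncong: "\<And>i j k. i \<noteq> j \<Longrightarrow> v $ i - v $ j \<noteq> of_int (int N * k)"
  defines "f \<equiv> \<lambda>a :: 'i \<Rightarrow> nat. orbit_sum (v + int_vec (\<chi> i. int (N * a i)))"
  assumes "N > 0"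
  shows "inj_on f UNIV" "free_vs.independent (range f)"
proof -
  let ?g = "\<lambda>a :: 'i \<Rightarrow> nat. v + int_vec (\<chi> i. int (N * a i))"
  have perm: "perm_vec p (?g a) = ?g b \<longleftrightarrow> p = id \<and> a = b" if p: "p \<in> Alt" for p a b
  proof
    assume eq: "perm_vec p (?g a) = ?g b"
    have "inv p i = i" for i
    proof (rule ccontr)
      assume "inv p i \<noteq> i"
      moreover have "v $ inv p i + of_int (int N * int (a (inv p i))) = v $ i + of_int (int N * int (b i))"
        using arg_cong[OF eq, of "\<lambda>x. x $ i"] by (simp add: perm_vec_def int_vec_def)
      then have "v $ inv p i - v $ i = of_int (int N * (int (b i) - int (a (inv p i))))"
        by (simp only: diff_eq_diff_if_add_eq_add of_int_diff right_diff_distrib)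
      ultimately show False using noncong by blast
    qed
    then have "inv p = id" by auto
    then have "p = id" using Alt_bij[OF p] by (metis inv_id inv_inv_eq)
    moreover from this have "a i = b i" for i
      using arg_cong[OF eq, of "\<lambda>x. x $ i"] \<open>N > 0\<close>
      by (simp add: perm_vec_def int_vec_def flip: of_nat_mult)
    ultimately show "p = id \<and> a = b" by auto
  qed (simp add: perm_vec_def vec_eq_iff)
  have "{p \<in> Alt. perm_vec p (?g a) = ?g b} = (if a = b then {id} else {})" for a b
    using perm by auto
  then have "Poly_Mapping.lookup (f a) (?g b) = (if a = b then 1 else 0)" for a b
    by (simp add: f_def lookup_orbit_sum)
  then show "inj_on f UNIV" "free_vs.independent (range f)"
    using inj_on_independent_by_evaluation[of UNIV f ?g] by simp_all
qed


text \<open>The cube of exponents at most \<open>m div CARD('i)\<close> lies in the simplex reached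
  in \<open>m\<close> steps and is easier to count.\<close>

lemma raising_power_space_independent:
  fixes v :: "'k::field_char_0 ^ 'i::finite"
  assumes "\<And>i j k. i \<noteq> j \<Longrightarrow> v $ i - v $ j \<noteq> of_int (int N * k)" and "N > 0"
  shows "\<exists>S \<subseteq> power_space fscale weyl_act (raising_space N) (free_vs.span {orbit_sum v}) m.
    free_vs.independent S \<and> (1 / real CARD('i)) ^ CARD('i) * real m ^ CARD('i) \<le> real (card S)"
proof -
  let ?n = "CARD('i)"
  let ?f = "\<lambda>a :: 'i \<Rightarrow> nat. orbit_sum (v + int_vec (\<chi> i. int (N * a i)))"
  let ?A = "PiE (UNIV :: 'i set) (\<lambda>_. {..m div ?n})"
  have ind: "inj_on ?f UNIV" "free_vs.independent (range ?f)"
    using independent_orbit_sums[of v N] assms by blast+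
  have "sum a UNIV \<le> m" if "a \<in> ?A" for a
  proof -
    have "sum a UNIV \<le> (\<Sum>i\<in>(UNIV :: 'i set). m div ?n)"
      using that by (intro sum_mono) (auto simp: PiE_iff)
    also have "\<dots> \<le> m" by simp
    finally show ?thesis .
  qed
  then have "?f ` ?A \<subseteq> power_space fscale weyl_act (raising_space N) (free_vs.span {orbit_sum v}) m"
    using raising_power_space[OF assms(1)] by blast
  moreover have "free_vs.independent (?f ` ?A)"
    using ind(2) by (rule free_vs.independent_mono) (rule image_mono, simp)
  moreover have "(1 / real ?n) ^ ?n * real m ^ ?n \<le> real (card (?f ` ?A))"
  proof -
    have "card (?f ` ?A) = card ?A"
      using ind(1) by (intro card_image) (blast intro: inj_on_subset)
    also have "\<dots> = Suc (m div ?n) ^ ?n"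
      by (simp add: card_PiE)
    finally have card: "real (card (?f ` ?A)) = real (Suc (m div ?n)) ^ ?n" by simp
    \<comment> \<open>The exponent 0 contributes the \<open>Suc\<close>, which compensates for the
      rounding in the division.\<close>
    have "m < Suc (m div ?n) * ?n"
      using zero_less_card_finite[where 'a = 'i] by (simp only: dividend_less_div_times mult_Suc)
    then have "real m \<le> real (Suc (m div ?n)) * real ?n"
      by (metis less_imp_le of_nat_le_iff of_nat_mult)
    then have "real m / real ?n \<le> real (Suc (m div ?n))"
      using zero_less_card_finite[where 'a = 'i] by (simp add: pos_divide_le_eq del: of_nat_Suc)
    then have "(real m / real ?n) ^ ?n \<le> real (Suc (m div ?n)) ^ ?n"
      by (intro power_mono) simp_all
    then show ?thesis by (simp only: card) (simp add: power_divide)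
  qed
  ultimately show ?thesis by blast
qed


section \<open>The Gelfand-Kirillov dimension\<close>

text \<open>The logarithm to base \<open>m\<close> is \<open>n\<close> plus
  \<open>ln C / ln m\<close>, so the constant disappears in the limit.\<close>

lemma log_growth_tendsto:
  assumes "C > 0"
  shows "((\<lambda>m. ereal (log (real m) (C * real m ^ n))) \<longlongrightarrow> ereal (real n)) sequentially"
proof -
  have "((\<lambda>m. ln C / ln (real m)) \<longlongrightarrow> 0) sequentially"
    by (rule real_tendsto_divide_at_top[OF tendsto_const
        filterlim_compose[OF ln_at_top filterlim_real_sequentially]])
  from tendsto_add[OF this tendsto_const]
  have "((\<lambda>m. ln C / ln (real m) + real n) \<longlongrightarrow> 0 + real n) sequentially" .
  moreover have "eventually (\<lambda>m. ln C / ln (real m) + real n = log (real m) (C * real m ^ n)) sequentially"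
    using eventually_ge_at_top[of 2]
  proof eventually_elim
    case (elim m)
    then have "ln (real m) \<noteq> 0" by simp
    with elim assms show ?case
      by (simp add: log_def ln_mult ln_realpow add_divide_distrib)
  qed
  ultimately have "((\<lambda>m. log (real m) (C * real m ^ n)) \<longlongrightarrow> real n) sequentially"
    by (simp only: add_0_left) (rule Lim_transform_eventually)
  then show ?thesis by (rule tendsto_ereal)
qed

lemma GK_dim_T_invariants:
  fixes \<beta> :: "'k::field_char_0 ^ 'i::finite"
  shows "GK_dim weyl_scale fscale weyl_invariants (T_invariants \<beta>) weyl_act = ereal (real CARD('i))"
proof (rule antisym)
  let ?n = "CARD('i)"
  let ?dim = "\<lambda>V F m. free_vs.dim (power_space fscale weyl_act V F m)"
  let ?good = "\<lambda>V F. finite_dim_subspace weyl_scale V \<and> 1 \<in> V \<and> V \<subseteq> weyl_invariants \<and>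
    finite_dim_subspace fscale F \<and> F \<subseteq> T_invariants \<beta>"
  have upper: "limsup (\<lambda>m. ereal (log (real m) (real (?dim V F m)))) \<le> ereal (real ?n)"
    if fin: "finite_dim_subspace weyl_scale V" "finite_dim_subspace fscale F"
    for V :: "('i, 'k) weyl set" and F
  proof -
    obtain C where C: "C > 0" "\<And>m. m \<ge> 1 \<Longrightarrow> \<exists>B. finite B \<and>
        power_space fscale weyl_act V F m \<subseteq> free_vs.span B \<and> real (card B) \<le> C * real m ^ ?n"
      using power_space_spanned[OF fin] by blast
    \<comment> \<open>A constant of at least 1 makes the logarithm of the bound nonnegative. This
      covers dimension 0, where the logarithm has the default value 0.\<close>
    obtain D where D: "C \<le> D" "1 \<le> D"
      using max.cobounded1 max.cobounded2 by blast
    have "eventually (\<lambda>m. ereal (log (real m) (real (?dim V F m)))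
        \<le> ereal (log (real m) (D * real m ^ ?n))) sequentially"
      using eventually_ge_at_top[of 2]
    proof eventually_elim
      case (elim m)
      then obtain B where B: "finite B" "power_space fscale weyl_act V F m \<subseteq> free_vs.span B"
        "real (card B) \<le> C * real m ^ ?n"
        using C(2)[of m] order_trans[OF one_le_numeral elim] by blast
      have "real (?dim V F m) \<le> C * real m ^ ?n"
        using free_vs.dim_le_card[OF B(2,1)] B(3) by linarith
      also have "\<dots> \<le> D * real m ^ ?n" using D by (intro mult_right_mono) simp_all
      finally have le: "real (?dim V F m) \<le> D * real m ^ ?n" .
      have "1 * 1 \<le> D * real m ^ ?n"
        using elim D by (intro mult_mono one_le_power) simp_all
      then have ge: "1 \<le> D * real m ^ ?n" by simp
      have "log (real m) (real (?dim V F m)) \<le> log (real m) (D * real m ^ ?n)"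
      proof (cases "?dim V F m = 0")
        case True
        have "0 \<le> log (real m) (D * real m ^ ?n)"
          using elim ge by (intro zero_le_log_cancel_iff[THEN iffD2]) simp_all
        then show ?thesis unfolding True by (simp add: log_def)
      next
        case False
        then show ?thesis using elim le by (intro log_mono) simp_all
      qed
      then show ?case by (simp only: ereal_less_eq)
    qed
    then have "limsup (\<lambda>m. ereal (log (real m) (real (?dim V F m))))
        \<le> limsup (\<lambda>m. ereal (log (real m) (D * real m ^ ?n)))"
      by (rule Limsup_mono)
    also have "\<dots> = ereal (real ?n)"
      using D by (intro lim_imp_Limsup log_growth_tendsto) simp_all
    finally show ?thesis .
  qed
  then show "GK_dim weyl_scale fscale weyl_invariants (T_invariants \<beta>) weyl_act \<le> ereal (real ?n)"
    unfolding GK_dim_def by (intro SUP_least) (clarify, rule upper)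
  obtain z N where N: "N > 0" and
    "\<forall>i j k. i \<noteq> j \<longrightarrow> (\<beta> + int_vec z) $ i - (\<beta> + int_vec z) $ j \<noteq> of_int (int N * k)"
    using exists_noncongruent_translate[of \<beta>] by blast
  then have noncong: "\<And>i j k. i \<noteq> j \<Longrightarrow> (\<beta> + int_vec z) $ i - (\<beta> + int_vec z) $ j \<noteq> of_int (int N * k)"
    by blast
  \<comment> \<open>For the supremum a single pair of subspaces with growth of degree
    \<open>CARD('i)\<close> is enough.\<close>
  let ?v = "\<beta> + int_vec z"
  let ?V = "raising_space N :: ('i, 'k) weyl set"
  let ?F = "free_vs.span {orbit_sum ?v}"
  have "1 \<in> ?V" unfolding raising_space_def by (intro weyl_vs.span_base) simp
  moreover have V: "finite_dim_subspace weyl_scale ?V"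
    unfolding finite_dim_subspace_def raising_space_def by (rule exI, rule conjI[OF _ refl]) simp
  moreover have "1 \<in> (weyl_invariants :: ('i, 'k) weyl set)"
    by (simp add: weyl_invariants_def Alt_inj)
  then have "?V \<subseteq> weyl_invariants"
    unfolding raising_space_def using raising_invariant
    by (intro weyl_vs.span_minimal weyl_invariants_subspace) auto
  moreover have F: "finite_dim_subspace fscale ?F"
    unfolding finite_dim_subspace_def by (rule exI, rule conjI[OF _ refl]) simp
  moreover have "?F \<subseteq> T_invariants \<beta>"
    using orbit_sum_in_T_invariants[OF affine_orbit_int_vec]
    by (intro free_vs.span_minimal T_invariants_subspace) auto
  ultimately have good: "?good ?V ?F" by blast
  let ?c = "(1 / real ?n) ^ ?n"
  have c: "?c > 0" using zero_less_card_finite[where 'a = 'i] by simp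
  have "eventually (\<lambda>m. ereal (log (real m) (?c * real m ^ ?n))
      \<le> ereal (log (real m) (real (?dim ?V ?F m)))) sequentially"
    using eventually_ge_at_top[of 2]
  proof eventually_elim
    case (elim m)
    obtain S where S: "S \<subseteq> power_space fscale weyl_act ?V ?F m" "free_vs.independent S"
      "?c * real m ^ ?n \<le> real (card S)"
      using raising_power_space_independent[of ?v N m] noncong N by blast
    obtain B where B: "B \<subseteq> power_space fscale weyl_act ?V ?F m" "free_vs.independent B"
      "power_space fscale weyl_act ?V ?F m \<subseteq> free_vs.span B" "card B = ?dim ?V ?F m"
      by (rule free_vs.basis_exists[of "power_space fscale weyl_act ?V ?F m"])
    \<comment> \<open>The spanning set from the upper bound shows that \<open>B\<close> is finite,
      so that \<open>dim\<close> is a true bound for independent sets and not the default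
      cardinality of an infinite set.\<close>
    obtain D where "finite D" "power_space fscale weyl_act ?V ?F m \<subseteq> free_vs.span D"
      using power_space_spanned[OF V F] order_trans[OF one_le_numeral elim] by blast
    then have "finite B"
      using free_vs.independent_span_bound[of D B] B by blast
    then have "card S \<le> ?dim ?V ?F m"
      using free_vs.independent_span_bound[of B S] S B by auto
    with S(3) have "?c * real m ^ ?n \<le> real (?dim ?V ?F m)" by linarith
    moreover have "?c * real m ^ ?n > 0" using c elim by simp
    ultimately have "log (real m) (?c * real m ^ ?n) \<le> log (real m) (real (?dim ?V ?F m))"
      using elim by (intro log_mono) simp_all
    then show ?case by (simp only: ereal_less_eq)
  qed
  then have "limsup (\<lambda>m. ereal (log (real m) (?c * real m ^ ?n)))
      \<le> limsup (\<lambda>m. ereal (log (real m) (real (?dim ?V ?F m))))"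
    by (rule Limsup_mono)
  moreover have "limsup (\<lambda>m. ereal (log (real m) (?c * real m ^ ?n))) = ereal (real ?n)"
    using c by (intro lim_imp_Limsup log_growth_tendsto) simp_all
  ultimately have lower: "ereal (real ?n) \<le> limsup (\<lambda>m. ereal (log (real m) (real (?dim ?V ?F m))))"
    by (simp only:)
  show "ereal (real ?n) \<le> GK_dim weyl_scale fscale weyl_invariants (T_invariants \<beta>) weyl_act"
    unfolding GK_dim_def
  proof (rule SUP_upper2)
    show "(?V, ?F) \<in> {(V, F). ?good V F}" using good by (simp only: mem_Collect_eq prod.case)
  qed (use lower in \<open>simp only: prod.case\<close>)
qed

theorem corollary5p17:
  fixes \<beta> :: "'k::{alg_closed_field, field_char_0} ^ 'n::finite"
  shows "holonomic fscale (T_invariants \<beta>) (\<lambda>w. skew_act (skew_of_weyl w))"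
proof -
  have "(\<lambda>w. skew_act (skew_of_weyl w)) = (weyl_act :: ('n, 'k) weyl \<Rightarrow> _)"
    by (simp add: fun_eq_iff)
  then show ?thesis
    unfolding holonomic_def
    using algebra_module_T_invariants[of \<beta>] finitely_generated_T_invariants[of \<beta>]
      GK_dim_T_invariants[of \<beta>] by simp
qed

end
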